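(* Let $K$ be a field, $n\ge 1$, let $X=(x_{ij})$ be an $n\times n$ matrix that is either generic or generic symmetric, let $Y=(y_1,\dots,y_n)^T$ be a generic $n\times 1$ matrix, let $R$ be the polynomial ring over $K$ in the entries of $X$ and the $y_j$, and let $\mathcal{I}=I_1(XY)=\langle g_1,\dots,g_n\rangle$, where $g_i$ is the $i$-th entry of $XY$. Then $\mathcal{I}$ is minimally resolved by the Koszul complex on $g_1,\dots,g_n$, and the $i$-th Betti number of $\mathcal{I}$ is $\binom{n}{i}$.
   Context: Generic means that all $n^2$ entries of $X$ are independent indeterminates; generic symmetric means $x_{ij}=x_{ji}$ and the entries $x_{ij}$ with $i\le j$ are independent indeterminates. The $y_j$ are further independent indeterminates. Convention: a resolution of, and the Betti numbers of, the ideal $\mathcal{I}$ refer to the minimal graded free resolution of $R/\mathcal{I}$ over $R$ ($i$-th Betti number = rank of the free module in homological degree $i$, starting with $R$ in degree $0$). *)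

theory Defs
  imports "HOL-Analysis.Finite_Cartesian_Product" "HOL-Library.Poly_Mapping"
begin

section \<open>Polynomial rings\<close>

text \<open>The ring of polynomials over \<open>'k\<close> whose indeterminates are exactly the elements of \<open>'v\<close>;
  a polynomial maps monomials (finitely supported exponent vectors) to coefficients.\<close>

type_synonym ('v, 'k) mpoly = "('v \<Rightarrow>\<^sub>0 nat) \<Rightarrow>\<^sub>0 'k"

definition indet :: "'v \<Rightarrow> ('v, 'k::comm_ring_1) mpoly" where
  "indet v = Poly_Mapping.single (Poly_Mapping.single v 1) 1"

definition monomial_degree :: "('v \<Rightarrow>\<^sub>0 nat) \<Rightarrow> nat" where
  "monomial_degree m = (\<Sum>v\<in>Poly_Mapping.keys m. Poly_Mapping.lookup m v)"

text \<open>Every indeterminate has degree 1. The zero polynomial is homogeneous of every degree, and the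
  only one of negative degree.\<close>

definition homogeneous :: "int \<Rightarrow> ('v, 'k::comm_ring_1) mpoly \<Rightarrow> bool" where
  "homogeneous d p \<longleftrightarrow> (\<forall>m\<in>Poly_Mapping.keys p. int (monomial_degree m) = d)"

text \<open>The ideal generated by all the indeterminates: no constant term.\<close>

definition irrelevant_ideal :: "('v, 'k::comm_ring_1) mpoly set" where
  "irrelevant_ideal = {p. Poly_Mapping.lookup p 0 = 0}"

global_interpretation ring_as_module: module "(*) :: 'a::comm_ring_1 \<Rightarrow> 'a \<Rightarrow> 'a"
  defines ideal_generated = ring_as_module.span
  by standard (simp_all add: algebra_simps)


section \<open>Generic and generic symmetric matrices\<close>

text \<open>Here \<open>x i j\<close> and \<open>y j\<close> are the names of the indeterminates in the entries of \<open>X\<close> and \<open>Y\<close>.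
  Surjectivity in \<open>bij_betw\<close> says that the ring has no further indeterminates.\<close>

definition generic :: "('n \<Rightarrow> 'n \<Rightarrow> 'v) \<Rightarrow> ('n \<Rightarrow> 'v) \<Rightarrow> bool" where
  "generic x y \<longleftrightarrow> bij_betw (case_sum (\<lambda>(i, j). x i j) y) (UNIV <+> UNIV) UNIV"

definition generic_symmetric :: "('n::linorder \<Rightarrow> 'n \<Rightarrow> 'v) \<Rightarrow> ('n \<Rightarrow> 'v) \<Rightarrow> bool" where
  "generic_symmetric x y \<longleftrightarrow>
     (\<forall>i j. x i j = x j i) \<and>
     bij_betw (case_sum (\<lambda>(i, j). x i j) y) ({(i, j). i \<le> j} <+> UNIV) UNIV"


section \<open>Graded free complexes and resolutions\<close>

text \<open>A sequence \<open>\<dots> \<rightarrow> F\<^sub>2 \<rightarrow> F\<^sub>1 \<rightarrow> F\<^sub>0\<close> of graded free modules \<open>F\<^sub>i = \<Oplus>\<^sub>b R(- shift F i b)\<close>, where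
  \<open>b\<close> ranges over \<open>basis F i\<close>. The matrix \<open>diff_matrix F i\<close> (row index first) describes the
  map \<open>F\<^sub>i\<^sub>+\<^sub>1 \<rightarrow> F\<^sub>i\<close>, so the numbering is by the target. Only entries with indices in
  the bases matter.\<close>

record (overloaded) ('b, 'v, 'k) free_complex =
  basis :: "nat \<Rightarrow> 'b set"
  shift :: "nat \<Rightarrow> 'b \<Rightarrow> int"
  diff_matrix :: "nat \<Rightarrow> 'b \<Rightarrow> 'b \<Rightarrow> ('v, 'k) mpoly"

definition free_module :: "'b set \<Rightarrow> ('b \<Rightarrow> 'a::comm_ring_1) set" where
  "free_module B = {v. \<forall>b. b \<notin> B \<longrightarrow> v b = 0}"

definition differential ::
  "('b, 'v, 'k::comm_ring_1) free_complex \<Rightarrow> nat \<Rightarrow> ('b \<Rightarrow> ('v, 'k) mpoly) \<Rightarrow> 'b \<Rightarrow> ('v, 'k) mpoly" where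
  "differential F i v =
     (\<lambda>c. if c \<in> basis F i then \<Sum>b\<in>basis F (Suc i). diff_matrix F i c b * v b else 0)"

text \<open>Modules of finite rank and maps that are homogeneous of degree 0.\<close>

definition graded_free :: "('b, 'v, 'k::comm_ring_1) free_complex \<Rightarrow> bool" where
  "graded_free F \<longleftrightarrow>
     (\<forall>i. finite (basis F i)) \<and>
     (\<forall>i. \<forall>c\<in>basis F i. \<forall>b\<in>basis F (Suc i).
        homogeneous (shift F (Suc i) b - shift F i c) (diff_matrix F i c b))"

text \<open>A resolution of \<open>R/I\<close> with \<open>F\<^sub>0 = R\<close> and the canonical projection \<open>R \<rightarrow> R/I\<close> as augmentation;
  exactness at \<open>F\<^sub>0\<close> says that the image of \<open>F\<^sub>1 \<rightarrow> F\<^sub>0\<close> is \<open>I\<close>. For a proper homogeneous ideal every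
  minimal graded free resolution of \<open>R/I\<close> has this form, up to the choice of a generator of \<open>F\<^sub>0\<close>.\<close>

definition graded_free_resolution ::
  "('b, 'v, 'k::comm_ring_1) free_complex \<Rightarrow> ('v, 'k) mpoly set \<Rightarrow> bool" where
  "graded_free_resolution F I \<longleftrightarrow>
     graded_free F \<and>
     (\<exists>e. basis F 0 = {e} \<and> shift F 0 e = 0 \<and>
        differential F 0 ` free_module (basis F 1) = {v \<in> free_module (basis F 0). v e \<in> I}) \<and>
     (\<forall>i. differential F (Suc i) ` free_module (basis F (Suc (Suc i))) =
        {v \<in> free_module (basis F (Suc i)). differential F i v = (\<lambda>_. 0)})"

definition minimal_graded_free_resolution ::
  "('b, 'v, 'k::comm_ring_1) free_complex \<Rightarrow> ('v, 'k) mpoly set \<Rightarrow> bool" where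
  "minimal_graded_free_resolution F I \<longleftrightarrow>
     graded_free_resolution F I \<and>
     (\<forall>i. \<forall>v\<in>free_module (basis F (Suc i)). \<forall>c. differential F i v c \<in> irrelevant_ideal)"

text \<open>The \<open>i\<close>-th Betti number of \<open>R/I\<close>. Natural numbers suffice to label the bases, as these are
  finite. The value is unspecified unless a minimal graded free resolution exists and the
  rank does not depend on its choice.\<close>

definition betti_number :: "('v, 'k::comm_ring_1) mpoly set \<Rightarrow> nat \<Rightarrow> nat" where
  "betti_number I i =
     (THE r. \<exists>F :: (nat, 'v, 'k) free_complex.
        minimal_graded_free_resolution F I \<and> card (basis F i) = r)"


section \<open>The Koszul complex\<close>

text \<open>The Koszul complex on forms \<open>g i\<close> of degree \<open>d i\<close>. The subset \<open>S = {s\<^sub>1 < \<dots> < s\<^sub>p}\<close> stands for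
  \<open>e\<^sub>S = e\<^bsub>s\<^sub>1\<^esub> \<and> \<dots> \<and> e\<^bsub>s\<^sub>p\<^esub>\<close>, and the differential sends
  \<open>e\<^sub>S\<close> to the sum over \<open>s \<in> S\<close> of \<open>\<plusminus> g s\<close> times the basis element of \<open>S - {s}\<close>, with sign \<open>(-1)\<close> to
  the number of elements of \<open>S\<close> below \<open>s\<close>.\<close>

definition koszul_complex ::
  "('n::{finite,linorder} \<Rightarrow> int) \<Rightarrow> ('n \<Rightarrow> ('v, 'k::comm_ring_1) mpoly) \<Rightarrow> ('n set, 'v, 'k) free_complex" where
  "koszul_complex d g =
     \<lparr>basis = (\<lambda>p. {S. card S = p}),
      shift = (\<lambda>p S. \<Sum>s\<in>S. d s),
      diff_matrix = (\<lambda>p T S. \<Sum>s\<in>S. if T = S - {s} then (-1) ^ card {t\<in>S. t < s} * g s else 0)\<rparr>"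

end

theory Submission
  imports Defs "HOL-Library.Function_Algebras"
begin

text \<open>Write \<open>g\<^sub>i = x\<^sub>i\<^sub>i y\<^sub>i + (\<Sum>j\<noteq>i. x\<^sub>i\<^sub>j y\<^sub>j)\<close> and give a monomial its degree in the diagonal
  indeterminates \<open>x\<^sub>k\<^sub>k\<close> as weight. Whether \<open>X\<close> is generic or generic symmetric, an indeterminate
  \<open>x\<^sub>k\<^sub>k\<close> occurs in \<open>X\<close> only at the place \<open>(k, k)\<close>. So \<open>x\<^sub>i\<^sub>i y\<^sub>i\<close> has weight 1 and all other terms of
  \<open>g\<^sub>i\<close> have weight 0: the form of highest weight of \<open>g\<^sub>i\<close> is the monomial \<open>x\<^sub>i\<^sub>i y\<^sub>i\<close>, and for
  different \<open>i\<close> these monomials have no indeterminate in common.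

  The Koszul complex on pairwise coprime monomials is a direct sum of strands, one for each
  multidegree, and each strand is the augmented chain complex of a full simplex. Coning off the
  smallest vertex of that simplex gives an explicit homotopy that contracts the complex in
  positive homological degrees (\<open>homotopy_identity\<close>). When the leading monomials are replaced by
  the \<open>g\<^sub>i\<close>, the same homotopy is a contraction up to terms of smaller weight. Hence a cycle
  differs from a boundary by a cycle of smaller weight, and as weights are natural numbers, after
  finitely many corrections every cycle of positive homological degree is a boundary
  (\<open>koszul_exact\<close>). So the Koszul complex on the \<open>g\<^sub>i\<close> is a resolution. It is minimal since no
  \<open>g\<^sub>i\<close> has a constant term.

  That the Betti numbers are the ranks \<open>n choose i\<close> of this complex needs the invariance of ranks. If
  \<open>F\<close> and \<open>G\<close> resolve the same module and \<open>F\<close> is minimal, then lifting the identity gives chain maps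
  \<open>\<phi> : F \<rightarrow> G\<close> and \<open>\<psi> : G \<rightarrow> F\<close> with \<open>\<psi> \<circ> \<phi>\<close> homotopic to the identity
  (\<open>comparison_maps\<close>). By minimality of \<open>F\<close>, \<open>\<psi> \<circ> \<phi>\<close> is then the identity modulo the
  irrelevant ideal, that is, after passing to constant coefficients; so linear algebra over the field
  bounds the ranks of \<open>F\<close> by those of \<open>G\<close> (\<open>minimal_resolution_rank_le\<close>). Between two minimal
  resolutions the inequality holds both ways.\<close>

section \<open>Coefficients of products of polynomials\<close>

definition monomial_dvd :: "('v \<Rightarrow>\<^sub>0 nat) \<Rightarrow> ('v \<Rightarrow>\<^sub>0 nat) \<Rightarrow> bool" where
  "monomial_dvd m b \<longleftrightarrow> (\<forall>v. Poly_Mapping.lookup m v \<le> Poly_Mapping.lookup b v)"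

lemma monomial_dvd_add_diff:
  "monomial_dvd m b \<Longrightarrow> m + (b - m) = b"
  by (rule poly_mapping_eqI) (simp add: monomial_dvd_def lookup_add lookup_minus)

lemma monomial_dvd_add_left [simp]: "monomial_dvd m (m + b)"
  by (simp add: monomial_dvd_def lookup_add)

lemma lookup_monomial_mult:
  fixes p :: "('v, 'k::comm_ring_1) mpoly"
  shows "Poly_Mapping.lookup (Poly_Mapping.single m 1 * p) b =
    (if monomial_dvd m b then Poly_Mapping.lookup p (b - m) else 0)"
proof -
  have "Poly_Mapping.lookup (Poly_Mapping.single m 1 * p) b =
      (\<Sum>l. ((\<Sum>q. Poly_Mapping.lookup p q when b = m + q) when m = l))"
    unfolding lookup_mult by (rule arg_cong[of _ _ Sum_any]) (auto simp: lookup_single when_def fun_eq_iff)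
  also have "\<dots> = (\<Sum>q. Poly_Mapping.lookup p q when b = m + q)"
    by simp
  also have "\<dots> = (if monomial_dvd m b then Poly_Mapping.lookup p (b - m) else 0)"
  proof (cases "monomial_dvd m b")
    case True
    have "b = m + q \<longleftrightarrow> b - m = q" for q
      using monomial_dvd_add_diff[OF True] by auto
    then show ?thesis using True by simp
  next
    case False
    then have "b \<noteq> m + q" for q by auto
    then show ?thesis using False by simp
  qed
  finally show ?thesis .
qed

text \<open>The constant coefficient is a ring homomorphism, because a sum of exponent vectors vanishes only
  if both summands do.\<close>

lemma lookup_times_zero:
  fixes p q :: "('v, 'k::comm_ring_1) mpoly"
  shows "Poly_Mapping.lookup (p * q) 0 = Poly_Mapping.lookup p 0 * Poly_Mapping.lookup q 0"
proof -
  have *: "(0::'v \<Rightarrow>\<^sub>0 nat) = l + r \<longleftrightarrow> 0 = l \<and> 0 = r" for l r :: "'v \<Rightarrow>\<^sub>0 nat"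
    by (auto simp: poly_mapping_eq_iff lookup_add fun_eq_iff)
  have "Poly_Mapping.lookup (p * q) 0 =
      (\<Sum>l. (Poly_Mapping.lookup p l * Poly_Mapping.lookup q 0 when 0 = l))"
    unfolding lookup_mult
  proof (rule arg_cong[of _ _ Sum_any], rule ext)
    fix l :: "'v \<Rightarrow>\<^sub>0 nat"
    show "Poly_Mapping.lookup p l * (\<Sum>r. Poly_Mapping.lookup q r when 0 = l + r) =
      (Poly_Mapping.lookup p l * Poly_Mapping.lookup q 0 when 0 = l)"
      by (cases "0 = l") (simp_all only: * simp_thms when_simps Sum_any_when_equal' Sum_any.neutral mult_zero_right)
  qed
  then show ?thesis by simp
qed

section \<open>Linear maps between free modules\<close>

definition fun_scale :: "'a::comm_ring_1 \<Rightarrow> ('b \<Rightarrow> 'a) \<Rightarrow> 'b \<Rightarrow> 'a" where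
  "fun_scale r v = (\<lambda>b. r * v b)"

definition unit_vector :: "'b \<Rightarrow> 'b \<Rightarrow> 'a::comm_ring_1" where
  "unit_vector b = (\<lambda>c. if c = b then 1 else 0)"

lemma module_fun_scale: "module (fun_scale :: 'a::comm_ring_1 \<Rightarrow> ('b \<Rightarrow> 'a) \<Rightarrow> 'b \<Rightarrow> 'a)"
  by (rule module.intro)
     (rule ext, simp only: fun_scale_def plus_fun_apply distrib_left distrib_right mult.assoc mult_1)+

lemma module_homI:
  fixes f :: "('b \<Rightarrow> 'a::comm_ring_1) \<Rightarrow> ('c \<Rightarrow> 'a)"
  assumes "\<And>u v c. f (u + v) c = f u c + f v c" "\<And>r v c. f (fun_scale r v) c = r * f v c"
  shows "module_hom fun_scale fun_scale f"
  unfolding module_hom_iff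
proof (intro conjI module_fun_scale allI)
  show "f (u + v) = f u + f v" for u v
    by (rule ext) (simp add: assms(1))
  show "f (fun_scale r v) = fun_scale r (f v)" for r v
    by (rule ext) (simp only: assms(2) fun_scale_def[of r "f v"])
qed

lemma sum_fun_apply: "(\<Sum>i\<in>A. f i) x = (\<Sum>i\<in>A. f i x)"
  by (induction A rule: infinite_finite_induct) simp_all

lemma module_hom_free_expansion:
  fixes f :: "('b \<Rightarrow> 'a::comm_ring_1) \<Rightarrow> ('c \<Rightarrow> 'a)"
  assumes f: "module_hom fun_scale fun_scale f" and "finite B" "v \<in> free_module B"
  shows "f v = (\<Sum>b\<in>B. fun_scale (v b) (f (unit_vector b)))"
proof -
  have "v = (\<Sum>b\<in>B. fun_scale (v b) (unit_vector b))"
  proof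
    fix c
    have "(\<Sum>b\<in>B. fun_scale (v b) (unit_vector b)) c = (\<Sum>b\<in>B. if c = b then v b else 0)"
      unfolding sum_fun_apply by (rule sum.cong) (simp_all add: fun_scale_def unit_vector_def)
    also have "\<dots> = v c"
      using assms(2,3) by (simp add: free_module_def)
    finally show "v c = (\<Sum>b\<in>B. fun_scale (v b) (unit_vector b)) c" by (rule sym)
  qed
  then have "f v = f (\<Sum>b\<in>B. fun_scale (v b) (unit_vector b))" by (rule arg_cong)
  also have "\<dots> = (\<Sum>b\<in>B. fun_scale (v b) (f (unit_vector b)))"
    by (simp only: module_hom.sum[OF f] module_hom.scale[OF f])
  finally show ?thesis .
qed

lemma unit_vector_in_free: "b \<in> B \<Longrightarrow> unit_vector b \<in> free_module B"
  by (auto simp: unit_vector_def free_module_def)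

lemma free_module_zero [simp]: "0 \<in> free_module B"
  by (simp add: free_module_def)

lemma free_module_diff: "u \<in> free_module B \<Longrightarrow> v \<in> free_module B \<Longrightarrow> u - v \<in> free_module B"
  by (simp add: free_module_def)

text \<open>Free modules are projective: a preimage under \<open>d\<close> can be chosen for each unit vector, and the
  choice extends linearly.\<close>

lemma lift_along_image:
  fixes f :: "('b \<Rightarrow> 'a::comm_ring_1) \<Rightarrow> ('c \<Rightarrow> 'a)" and d :: "('e \<Rightarrow> 'a) \<Rightarrow> ('c \<Rightarrow> 'a)"
  assumes f: "module_hom fun_scale fun_scale f" and d: "module_hom fun_scale fun_scale d"
    and B: "finite B" and sub: "\<And>v. v \<in> free_module B \<Longrightarrow> f v \<in> d ` free_module C"
  obtains \<phi> where "module_hom fun_scale fun_scale \<phi>" "\<And>v. \<phi> v \<in> free_module C"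
    "\<And>v. v \<in> free_module B \<Longrightarrow> d (\<phi> v) = f v"
proof -
  have "\<forall>b\<in>B. \<exists>w. w \<in> free_module C \<and> f (unit_vector b) = d w"
    using sub[OF unit_vector_in_free] by (simp add: image_iff) blast
  then obtain w where w: "\<And>b. b \<in> B \<Longrightarrow> w b \<in> free_module C"
    "\<And>b. b \<in> B \<Longrightarrow> f (unit_vector b) = d (w b)"
    by metis
  define \<phi> where "\<phi> v = (\<Sum>b\<in>B. fun_scale (v b) (w b))" for v
  have "module_hom fun_scale fun_scale \<phi>"
    by (rule module_homI) (simp_all only: \<phi>_def sum_fun_apply fun_scale_def plus_fun_apply
        sum.distrib distrib_right sum_distrib_left mult.assoc)
  moreover have "\<phi> v \<in> free_module C" for v
    using w(1) by (simp add: \<phi>_def free_module_def sum_fun_apply fun_scale_def)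
  moreover have "d (\<phi> v) = f v" if "v \<in> free_module B" for v
    using that by (simp add: \<phi>_def module_hom_free_expansion[OF f B] module_hom.sum[OF d]
        module_hom.scale[OF d] w(2))
  ultimately show thesis by (rule that)
qed

lemma module_hom_differential: "module_hom fun_scale fun_scale (differential F i)"
proof (rule module_homI)
  show "differential F i (u + v) c = differential F i u c + differential F i v c" for u v c
    by (simp add: differential_def distrib_left sum.distrib)
  show "differential F i (fun_scale r v) c = r * differential F i v c" for r v c
    by (cases "c \<in> basis F i")
       (simp_all only: differential_def fun_scale_def if_True if_False sum_distrib_left
          mult.left_commute[of _ r] mult_zero_right)
qed

lemma differential_in_free: "differential F i v \<in> free_module (basis F i)"
  by (simp add: differential_def free_module_def)

section \<open>Comparison of resolutions\<close>

lemma irrelevant_ideal_sum: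
  "(\<And>i. i \<in> A \<Longrightarrow> f i \<in> irrelevant_ideal) \<Longrightarrow> sum f A \<in> irrelevant_ideal"
  by (simp add: irrelevant_ideal_def lookup_sum)

lemma irrelevant_ideal_mult: "p \<in> irrelevant_ideal \<Longrightarrow> p * q \<in> irrelevant_ideal"
  by (simp add: irrelevant_ideal_def lookup_times_zero)

lemma module_hom_irrelevant:
  fixes f :: "('b \<Rightarrow> ('v, 'k::comm_ring_1) mpoly) \<Rightarrow> ('c \<Rightarrow> ('v, 'k) mpoly)"
  assumes f: "module_hom fun_scale fun_scale f" and "finite B" "v \<in> free_module B"
    and "\<And>b. v b \<in> irrelevant_ideal"
  shows "f v c \<in> irrelevant_ideal"
  unfolding module_hom_free_expansion[OF assms(1-3)] sum_fun_apply
  by (rule irrelevant_ideal_sum) (simp only: fun_scale_def irrelevant_ideal_mult assms(4))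

text \<open>For a resolution of \<open>R/I\<close> these are the elements of \<open>I\<close> in degree 0 and the cycles in positive
  degrees. Speaking of boundaries treats both cases alike in the construction of chain maps.\<close>

definition boundaries :: "('b, 'v, 'k::comm_ring_1) free_complex \<Rightarrow> nat \<Rightarrow> ('b \<Rightarrow> ('v, 'k) mpoly) set" where
  "boundaries F n = differential F n ` free_module (basis F (Suc n))"

lemma boundaries_Suc:
  assumes "graded_free_resolution F I"
  shows "v \<in> boundaries F (Suc n) \<longleftrightarrow> v \<in> free_module (basis F (Suc n)) \<and> differential F n v = 0"
proof -
  have "boundaries F (Suc n) = {v \<in> free_module (basis F (Suc n)). differential F n v = (\<lambda>_. 0)}"
    unfolding boundaries_def using assms unfolding graded_free_resolution_def by blast
  then show ?thesis by (simp add: zero_fun_def)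
qed

lemma resolution_finite: "graded_free_resolution F I \<Longrightarrow> finite (basis F n)"
  by (simp add: graded_free_resolution_def graded_free_def)

text \<open>\<open>\<phi>\<close> and \<open>\<psi>\<close> are the components in degree \<open>n\<close> of chain maps between \<open>F\<close> and \<open>G\<close>, and \<open>h\<close> is the
  component of a homotopy from the identity to \<open>\<psi> \<circ> \<phi>\<close>. Commutation with the differentials of
  degree \<open>n\<close> is not recorded. For extending the data to degree \<open>n + 1\<close> it suffices to know what they do
  to boundaries, so that existence in all degrees follows by induction on \<open>n\<close>.\<close>

definition comparison_data where
  "comparison_data F G n \<phi> \<psi> h \<longleftrightarrow>
    module_hom fun_scale fun_scale \<phi> \<and> module_hom fun_scale fun_scale \<psi> \<and>
    module_hom fun_scale fun_scale h \<and>
    (\<forall>v. \<phi> v \<in> free_module (basis G n)) \<and> (\<forall>v. \<psi> v \<in> free_module (basis F n)) \<and>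
    (\<forall>v. h v \<in> free_module (basis F (Suc n))) \<and>
    (\<forall>u\<in>boundaries F n. \<phi> u \<in> boundaries G n) \<and>
    (\<forall>u\<in>boundaries G n. \<psi> u \<in> boundaries F n) \<and>
    (\<forall>u\<in>boundaries F n. differential F n (h u) = \<psi> (\<phi> u) - u) \<and>
    (\<forall>v\<in>free_module (basis F n). \<forall>b. (\<psi> (\<phi> v) - v) b \<in> irrelevant_ideal)"

text \<open>The next maps \<open>\<phi>'\<close> and \<open>\<psi>'\<close> lift \<open>\<phi> \<circ> d\<close> and \<open>\<psi> \<circ> d\<close>, where \<open>d\<close> stands for the differentials.
  The map \<open>\<psi>' \<circ> \<phi>' - id - h \<circ> d\<close> has its values in the cycles, hence lifts to \<open>h'\<close>. This yields
  \<open>\<psi>' \<circ> \<phi>' - id = d \<circ> h' + h \<circ> d\<close>. Minimality puts both summands into the irrelevant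
  ideal: \<open>d\<close> has its entries there, and \<open>h\<close> preserves such vectors.\<close>

lemma comparison_maps:
  fixes F :: "('b, 'v, 'k::comm_ring_1) free_complex" and G :: "('c, 'v, 'k) free_complex"
  assumes minF: "minimal_graded_free_resolution F I" and G: "graded_free_resolution G I"
  shows "\<exists>\<phi> \<psi> h. comparison_data F G n \<phi> \<psi> h"
proof (induction n)
  case 0
  obtain e where e: "basis F 0 = {e}" "boundaries F 0 = {v \<in> free_module {e}. v e \<in> I}"
    using minF by (auto simp: minimal_graded_free_resolution_def graded_free_resolution_def boundaries_def)
  obtain e' where e': "basis G 0 = {e'}" "boundaries G 0 = {v \<in> free_module {e'}. v e' \<in> I}"
    using G by (auto simp: graded_free_resolution_def boundaries_def)
  \<comment> \<open>In degree 0 both complexes are the ring itself, and the identity is lifted by the identity.\<close>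
  define \<phi> :: "('b \<Rightarrow> ('v, 'k) mpoly) \<Rightarrow> 'c \<Rightarrow> ('v, 'k) mpoly"
    where "\<phi> v = (\<lambda>c. if c = e' then v e else 0)" for v
  define \<psi> :: "('c \<Rightarrow> ('v, 'k) mpoly) \<Rightarrow> 'b \<Rightarrow> ('v, 'k) mpoly"
    where "\<psi> v = (\<lambda>c. if c = e then v e' else 0)" for v
  define h :: "('b \<Rightarrow> ('v, 'k) mpoly) \<Rightarrow> 'b \<Rightarrow> ('v, 'k) mpoly" where "h v = 0" for v
  have "module_hom fun_scale fun_scale \<phi>" "module_hom fun_scale fun_scale \<psi>"
    by (rule module_homI; simp add: \<phi>_def \<psi>_def fun_scale_def)+
  moreover have "module_hom fun_scale fun_scale h"
    by (rule module_homI) (simp_all add: h_def)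
  moreover have "h v \<in> free_module B" for v B
    by (simp add: h_def)
  moreover have "differential F 0 (h v) = 0" for v
    unfolding h_def by (rule module_hom.zero[OF module_hom_differential])
  moreover have "\<psi> (\<phi> v) = v" if "v \<in> free_module {e}" for v
    using that by (auto simp: \<phi>_def \<psi>_def free_module_def)
  moreover have "\<phi> v \<in> free_module {e'}" "\<psi> w \<in> free_module {e}" for v w
    by (auto simp: \<phi>_def \<psi>_def free_module_def)
  moreover have "\<forall>u\<in>boundaries F 0. \<phi> u \<in> boundaries G 0" "\<forall>u\<in>boundaries G 0. \<psi> u \<in> boundaries F 0"
    unfolding e e' by (auto simp: \<phi>_def \<psi>_def free_module_def)
  ultimately show ?case
    unfolding comparison_data_def e(1) e'(1)
    by (intro exI[of _ \<phi>] exI[of _ \<psi>] exI[of _ h]) (simp_all add: e(2) irrelevant_ideal_def)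
next
  case (Suc n)
  have F: "graded_free_resolution F I"
    and minimal: "\<And>i v c. v \<in> free_module (basis F (Suc i)) \<Longrightarrow> differential F i v c \<in> irrelevant_ideal"
    using minF by (auto simp: minimal_graded_free_resolution_def)
  let ?d = "differential F" and ?d' = "differential G"
  note d = module_hom_differential
  from Suc obtain \<phi> \<psi> h where data: "comparison_data F G n \<phi> \<psi> h" by (elim exE)
  have hom: "module_hom fun_scale fun_scale \<phi>" "module_hom fun_scale fun_scale \<psi>"
      "module_hom fun_scale fun_scale h"
    and into_h: "\<And>v. h v \<in> free_module (basis F (Suc n))"
    and \<phi>: "\<And>u. u \<in> boundaries F n \<Longrightarrow> \<phi> u \<in> boundaries G n"
    and \<psi>: "\<And>u. u \<in> boundaries G n \<Longrightarrow> \<psi> u \<in> boundaries F n"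
    and h: "\<And>u. u \<in> boundaries F n \<Longrightarrow> ?d n (h u) = \<psi> (\<phi> u) - u"
    using data unfolding comparison_data_def by (elim conjE; (assumption | blast))+
  have bd: "\<And>v. v \<in> free_module (basis F (Suc n)) \<Longrightarrow> ?d n v \<in> boundaries F n"
    and bd': "\<And>v. v \<in> free_module (basis G (Suc n)) \<Longrightarrow> ?d' n v \<in> boundaries G n"
    by (auto simp: boundaries_def)
  obtain \<phi>' where \<phi>': "module_hom fun_scale fun_scale \<phi>'" "\<And>v. \<phi>' v \<in> free_module (basis G (Suc n))"
    "\<And>v. v \<in> free_module (basis F (Suc n)) \<Longrightarrow> ?d' n (\<phi>' v) = (\<phi> \<circ> ?d n) v"
  proof (rule lift_along_image)
    show "module_hom fun_scale fun_scale (\<phi> \<circ> ?d n)" by (rule module_hom_compose[OF d hom(1)])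
    show "(\<phi> \<circ> ?d n) v \<in> ?d' n ` free_module (basis G (Suc n))" if "v \<in> free_module (basis F (Suc n))" for v
      using \<phi>[OF bd[OF that]] by (simp add: boundaries_def)
  qed (use d resolution_finite[OF F] in blast)+
  obtain \<psi>' where \<psi>': "module_hom fun_scale fun_scale \<psi>'" "\<And>v. \<psi>' v \<in> free_module (basis F (Suc n))"
    "\<And>v. v \<in> free_module (basis G (Suc n)) \<Longrightarrow> ?d n (\<psi>' v) = (\<psi> \<circ> ?d' n) v"
  proof (rule lift_along_image)
    show "module_hom fun_scale fun_scale (\<psi> \<circ> ?d' n)" by (rule module_hom_compose[OF d hom(2)])
    show "(\<psi> \<circ> ?d' n) v \<in> ?d n ` free_module (basis F (Suc n))" if "v \<in> free_module (basis G (Suc n))" for v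
      using \<psi>[OF bd'[OF that]] by (simp add: boundaries_def)
  qed (use d resolution_finite[OF G] in blast)+
  define f where "f = (\<lambda>v. ((\<psi>' \<circ> \<phi>') v - v) - (h \<circ> ?d n) v)"
  note pair = module_pair.intro[OF module_fun_scale module_fun_scale]
  have f: "module_hom fun_scale fun_scale f"
    unfolding f_def
    by (rule module_pair.module_hom_sub[OF pair module_pair.module_hom_sub[OF pair
          module_hom_compose[OF \<phi>'(1) \<psi>'(1)] module.module_hom_ident[OF module_fun_scale]]
          module_hom_compose[OF d hom(3)]])
  have dhom: "?d n (u - v) = ?d n u - ?d n v" "?d' n (w - z) = ?d' n w - ?d' n z" "?d n 0 = 0" for u v w z
    by (simp_all only: module_hom.diff[OF d] module_hom.zero[OF d])
  obtain h' where h': "module_hom fun_scale fun_scale h'" "\<And>v. h' v \<in> free_module (basis F (Suc (Suc n)))"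
    "\<And>v. v \<in> free_module (basis F (Suc n)) \<Longrightarrow> ?d (Suc n) (h' v) = f v"
  proof (rule lift_along_image[OF f d])
    fix v :: "'b \<Rightarrow> ('v, 'k) mpoly" assume v: "v \<in> free_module (basis F (Suc n))"
    have "?d n (f v) = \<psi> (\<phi> (?d n v)) - ?d n v - ?d n (h (?d n v))"
      by (simp add: f_def dhom \<psi>'(3)[OF \<phi>'(2)] \<phi>'(3)[OF v])
    also have "\<dots> = 0" by (simp add: h[OF bd[OF v]])
    finally have "?d n (f v) = 0" .
    moreover have "f v \<in> free_module (basis F (Suc n))"
      unfolding f_def comp_apply by (intro free_module_diff \<psi>'(2) v into_h)
    ultimately have "f v \<in> boundaries F (Suc n)"
      using boundaries_Suc[OF F] by blast
    then show "f v \<in> ?d (Suc n) ` free_module (basis F (Suc (Suc n)))"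
      by (simp add: boundaries_def)
  qed (use resolution_finite[OF F] in blast)+
  have "\<phi>' u \<in> boundaries G (Suc n)" if "u \<in> boundaries F (Suc n)" for u
    using that \<phi>'(2,3) by (simp add: boundaries_Suc[OF F] boundaries_Suc[OF G] module_hom.zero[OF hom(1)])
  moreover have "\<psi>' u \<in> boundaries F (Suc n)" if "u \<in> boundaries G (Suc n)" for u
    using that \<psi>'(2,3) by (simp add: boundaries_Suc[OF F] boundaries_Suc[OF G] module_hom.zero[OF hom(2)])
  moreover have "?d (Suc n) (h' u) = \<psi>' (\<phi>' u) - u" if "u \<in> boundaries F (Suc n)" for u
    using that h'(3)[of u] by (simp add: boundaries_Suc[OF F] f_def module_hom.zero[OF hom(3)])
  moreover have "(\<psi>' (\<phi>' v) - v) b \<in> irrelevant_ideal" if v: "v \<in> free_module (basis F (Suc n))" for v b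
  proof -
    have "\<psi>' (\<phi>' v) - v = ?d (Suc n) (h' v) + h (?d n v)"
      by (simp add: h'(3)[OF v] f_def)
    moreover have "?d (Suc n) (h' v) b \<in> irrelevant_ideal"
      by (rule minimal[OF h'(2)])
    moreover have "h (?d n v) b \<in> irrelevant_ideal"
      by (rule module_hom_irrelevant[OF hom(3) resolution_finite[OF F] differential_in_free minimal[OF v]])
    ultimately show ?thesis by (simp add: irrelevant_ideal_def lookup_add)
  qed
  ultimately have "comparison_data F G (Suc n) \<phi>' \<psi>' h'"
    using \<phi>'(1,2) \<psi>'(1,2) h'(1,2) unfolding comparison_data_def by simp
  then show ?case by (intro exI)
qed

section \<open>Ranks of minimal resolutions\<close>

text \<open>Taking constant coefficients turns \<open>\<phi>\<close> and \<open>\<psi>\<close> into matrices over the field whose product is the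
  identity on the span of \<open>B\<close>. So the columns of the first matrix are linearly independent vectors in
  the space with basis \<open>C\<close>.\<close>

lemma card_le_if_retract_mod_irrelevant:
  fixes \<phi> :: "('b \<Rightarrow> ('v, 'k::field) mpoly) \<Rightarrow> ('c \<Rightarrow> ('v, 'k) mpoly)"
  assumes \<phi>: "module_hom fun_scale fun_scale \<phi>" and \<psi>: "module_hom fun_scale fun_scale \<psi>"
    and fin: "finite B" "finite C" and into: "\<And>v. \<phi> v \<in> free_module C"
    and retract: "\<And>v b. v \<in> free_module B \<Longrightarrow> (\<psi> (\<phi> v) - v) b \<in> irrelevant_ideal"
  shows "card B \<le> card C"
proof -
  \<comment> \<open>The columns of \<open>\<phi>\<close> modulo the irrelevant ideal.\<close>
  define a where "a b = (\<lambda>c. Poly_Mapping.lookup (\<phi> (unit_vector b) c) 0)" for b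
  have indep: "x b' = 0" if zero: "(\<Sum>b\<in>B. fun_scale (x b) (a b)) = 0" and b': "b' \<in> B" for x b'
  proof -
    \<comment> \<open>With the scalars \<open>x\<close> as constant polynomials: if the columns cancel, then \<open>\<phi> v\<close> has its entries in
      the irrelevant ideal, hence so has \<open>\<psi> (\<phi> v)\<close>, hence so has \<open>v\<close>.\<close>
    define v :: "'b \<Rightarrow> ('v, 'k) mpoly" where "v b = (if b \<in> B then Poly_Mapping.single 0 (x b) else 0)" for b
    have v: "v \<in> free_module B" by (simp add: v_def free_module_def)
    have "\<phi> v c \<in> irrelevant_ideal" for c
    proof -
      have "Poly_Mapping.lookup (\<phi> v c) 0 = (\<Sum>b\<in>B. fun_scale (x b) (a b)) c"
        by (simp add: module_hom_free_expansion[OF \<phi> fin(1) v] sum_fun_apply lookup_sum fun_scale_def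
            lookup_times_zero a_def v_def)
      then show ?thesis by (simp add: zero irrelevant_ideal_def)
    qed
    then have "\<psi> (\<phi> v) b' \<in> irrelevant_ideal"
      by (rule module_hom_irrelevant[OF \<psi> fin(2) into])
    moreover have "(\<psi> (\<phi> v) - v) b' \<in> irrelevant_ideal" by (rule retract[OF v])
    ultimately have "Poly_Mapping.lookup (v b') 0 = 0"
      by (simp add: irrelevant_ideal_def lookup_minus)
    then show ?thesis using b' by (simp add: v_def)
  qed
  have inj: "inj_on a B"
  proof (rule inj_onI, rule ccontr)
    fix b b' assume b: "b \<in> B" "b' \<in> B" "a b = a b'" "b \<noteq> b'"
    \<comment> \<open>Equal columns amount to a relation with coefficients 1 and -1.\<close>
    define x :: "'b \<Rightarrow> 'k" where "x = unit_vector b - unit_vector b'"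
    have "(\<Sum>i\<in>B. fun_scale (x i) (a i)) c = 0" for c
    proof -
      have "(\<Sum>i\<in>B. fun_scale (x i) (a i)) c = (\<Sum>i\<in>B. (if i = b then a i c else 0) - (if i = b' then a i c else 0))"
        unfolding sum_fun_apply
        by (rule sum.cong) (simp_all add: x_def fun_scale_def unit_vector_def)
      also have "\<dots> = a b c - a b' c" using b(1,2) fin(1) by (simp add: sum_subtractf)
      finally show ?thesis using b(3) by simp
    qed
    then have "x b = 0" by (intro indep b(1) ext) simp
    then show False using b(4) by (simp add: x_def unit_vector_def)
  qed
  interpret V: vector_space "fun_scale :: 'k \<Rightarrow> ('c \<Rightarrow> 'k) \<Rightarrow> 'c \<Rightarrow> 'k"
    using module_fun_scale[unfolded module_def] by (simp only: vector_space_def)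
  have "V.independent (a ` B)"
  proof (rule V.independent_if_scalars_zero)
    fix y z assume *: "(\<Sum>w\<in>a ` B. fun_scale (y w) w) = 0" "z \<in> a ` B"
    then obtain b where "b \<in> B" "z = a b" by blast
    moreover have "(\<Sum>b\<in>B. fun_scale (y (a b)) (a b)) = 0"
      using *(1) by (simp only: sum.reindex[OF inj] o_def)
    ultimately show "y z = 0" using indep[of "\<lambda>b. y (a b)"] by blast
  qed (simp add: fin)
  moreover have "a ` B \<subseteq> V.span (unit_vector ` C)"
  proof (rule image_subsetI)
    fix b
    have "a b = (\<Sum>c\<in>C. fun_scale (a b c) (unit_vector c))"
    proof -
      have "a b \<in> free_module C"
        using into[of "unit_vector b"] by (simp add: a_def free_module_def)
      from module_hom_free_expansion[OF module.module_hom_ident[OF module_fun_scale] fin(2) this]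
      show ?thesis .
    qed
    moreover have "(\<Sum>c\<in>C. fun_scale (a b c) (unit_vector c)) \<in> V.span (unit_vector ` C)"
      by (intro V.span_sum V.span_scale V.span_base imageI)
    ultimately show "a b \<in> V.span (unit_vector ` C)" by (simp only:)
  qed
  ultimately have "card (a ` B) \<le> card (unit_vector ` C :: ('c \<Rightarrow> 'k) set)"
    using V.independent_span_bound[of "unit_vector ` C" "a ` B"] fin(2) by blast
  also have "\<dots> \<le> card C" by (rule card_image_le[OF fin(2)])
  finally show ?thesis by (simp add: card_image[OF inj])
qed

lemma minimal_resolution_rank_le:
  fixes F :: "('b, 'v, 'k::field) free_complex" and G :: "('c, 'v, 'k) free_complex"
  assumes F: "minimal_graded_free_resolution F I" and G: "graded_free_resolution G I"
  shows "card (basis F n) \<le> card (basis G n)"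
proof -
  have "graded_free_resolution F I" using F by (simp add: minimal_graded_free_resolution_def)
  then have fin: "finite (basis F n)" "finite (basis G n)" using G by (simp_all add: resolution_finite)
  obtain \<phi> \<psi> h where "comparison_data F G n \<phi> \<psi> h"
    using comparison_maps[OF F G, of n] by (elim exE)
  then show ?thesis
    unfolding comparison_data_def
    using card_le_if_retract_mod_irrelevant[of \<phi> \<psi> "basis F n" "basis G n"] fin by simp
qed

section \<open>Betti numbers and relabelling of bases\<close>

definition relabel :: "('b \<Rightarrow> 'c) \<Rightarrow> ('b, 'v, 'k) free_complex \<Rightarrow> ('c, 'v, 'k) free_complex" where
  "relabel f F = \<lparr>basis = (\<lambda>i. f ` basis F i), shift = (\<lambda>i c. shift F i (inv f c)),
     diff_matrix = (\<lambda>i c b. diff_matrix F i (inv f c) (inv f b))\<rparr>"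

definition extend_by_zero :: "('b \<Rightarrow> 'c) \<Rightarrow> ('b \<Rightarrow> 'a::zero) \<Rightarrow> 'c \<Rightarrow> 'a" where
  "extend_by_zero f v = (\<lambda>c. if c \<in> range f then v (inv f c) else 0)"

lemma basis_relabel [simp]: "basis (relabel f F) i = f ` basis F i"
  by (simp add: relabel_def)

lemma differential_relabel:
  assumes "inj f"
  shows "differential (relabel f F) i v = extend_by_zero f (differential F i (v \<circ> f))"
proof
  fix c
  have inj: "inj_on f A" for A using assms by (rule inj_on_subset) simp
  show "differential (relabel f F) i v c = extend_by_zero f (differential F i (v \<circ> f)) c"
  proof (cases "c \<in> range f")
    case True
    then obtain b where c: "c = f b" by blast
    then show ?thesis
      using assms
      by (simp add: differential_def relabel_def extend_by_zero_def sum.reindex[OF inj] inj_image_mem_iff)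
  next
    case False
    then show ?thesis by (auto simp: differential_def relabel_def extend_by_zero_def)
  qed
qed

lemma free_module_relabel:
  fixes f :: "'b \<Rightarrow> 'c" and v :: "'c \<Rightarrow> 'a::comm_ring_1" and w :: "'b \<Rightarrow> 'a"
  assumes "inj f"
  shows "(free_module (f ` B) :: ('c \<Rightarrow> 'a) set) = extend_by_zero f ` free_module B"
    and "v \<in> free_module (f ` B) \<Longrightarrow> v \<circ> f \<in> free_module B"
    and "v \<in> free_module (f ` B) \<Longrightarrow> extend_by_zero f (v \<circ> f) = v"
    and "extend_by_zero f w \<circ> f = w"
proof -
  show 1: "extend_by_zero f (v \<circ> f) = v" if "v \<in> free_module (f ` B)" for v :: "'c \<Rightarrow> 'a"
  proof
    fix c
    show "extend_by_zero f (v \<circ> f) c = v c"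
    proof (cases "c \<in> range f")
      case True
      then show ?thesis by (simp add: extend_by_zero_def f_inv_into_f)
    next
      case False
      then have "c \<notin> f ` B" by blast
      then show ?thesis using False that by (simp add: extend_by_zero_def free_module_def)
    qed
  qed
  show 2: "v \<circ> f \<in> free_module B" if "v \<in> free_module (f ` B)" for v :: "'c \<Rightarrow> 'a"
    using that assms by (simp add: free_module_def inj_image_mem_iff)
  have 3: "extend_by_zero f u \<in> free_module (f ` B)" if "u \<in> free_module B" for u :: "'b \<Rightarrow> 'a"
    unfolding free_module_def
  proof (intro CollectI allI impI)
    fix c assume c: "c \<notin> f ` B"
    show "extend_by_zero f u c = 0"
    proof (cases "c \<in> range f")
      case True
      then obtain b where "c = f b" by blast
      then show ?thesis using c that assms by (auto simp: extend_by_zero_def free_module_def)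
    qed (simp add: extend_by_zero_def)
  qed
  show "extend_by_zero f w \<circ> f = w" using assms by (auto simp: extend_by_zero_def)
  show "(free_module (f ` B) :: ('c \<Rightarrow> 'a) set) = extend_by_zero f ` free_module B"
  proof
    show "(free_module (f ` B) :: ('c \<Rightarrow> 'a) set) \<subseteq> extend_by_zero f ` free_module B"
    proof
      fix v :: "'c \<Rightarrow> 'a" assume v: "v \<in> free_module (f ` B)"
      show "v \<in> extend_by_zero f ` free_module B"
        using imageI[OF 2[OF v], of "extend_by_zero f"] by (simp only: 1[OF v])
    qed
  qed (use 3 in blast)
qed

lemma relabel_image_differential:
  assumes "inj f"
  shows "differential (relabel f F) i ` free_module (f ` B) =
    extend_by_zero f ` differential F i ` free_module B"
  by (simp add: differential_relabel[OF assms] free_module_relabel(1,4)[OF assms] image_image)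

lemma extend_by_zero_eq_0_iff:
  fixes v :: "'b \<Rightarrow> 'a::comm_ring_1"
  assumes "inj f" shows "extend_by_zero f v = (\<lambda>_. 0) \<longleftrightarrow> v = (\<lambda>_. 0)"
proof
  assume "extend_by_zero f v = (\<lambda>_. 0)"
  then have "extend_by_zero f v \<circ> f = (\<lambda>_. 0)" by (simp add: o_def)
  then show "v = (\<lambda>_. 0)" by (simp add: free_module_relabel(4)[OF assms])
qed (simp add: extend_by_zero_def)

lemma minimal_graded_free_resolution_relabel:
  assumes f: "inj f" and F: "minimal_graded_free_resolution F I"
  shows "minimal_graded_free_resolution (relabel f F) I"
proof -
  have res: "graded_free_resolution F I"
    and minimal: "\<And>i v c. v \<in> free_module (basis F (Suc i)) \<Longrightarrow> differential F i v c \<in> irrelevant_ideal"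
    using F by (simp_all add: minimal_graded_free_resolution_def)
  have gr: "graded_free (relabel f F)"
    using res f by (auto simp: graded_free_resolution_def graded_free_def relabel_def)
  obtain e where e: "basis F 0 = {e}" "shift F 0 e = 0"
    "differential F 0 ` free_module (basis F 1) = {v \<in> free_module (basis F 0). v e \<in> I}"
    using res unfolding graded_free_resolution_def by blast
  have exact: "differential F (Suc i) ` free_module (basis F (Suc (Suc i))) =
      {v \<in> free_module (basis F (Suc i)). differential F i v = (\<lambda>_. 0)}" for i
    using res unfolding graded_free_resolution_def by blast
  have "basis (relabel f F) 0 = {f e}" "shift (relabel f F) 0 (f e) = 0"
    using e(1,2) f by (simp_all add: relabel_def)
  moreover have "differential (relabel f F) 0 ` free_module (basis (relabel f F) 1) =
      {v \<in> free_module (basis (relabel f F) 0). v (f e) \<in> I}"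
  proof -
    have "differential (relabel f F) 0 ` free_module (basis (relabel f F) 1) =
        extend_by_zero f ` {v \<in> free_module (basis F 0). v e \<in> I}"
      by (simp only: basis_relabel relabel_image_differential[OF f] e(3))
    also have "\<dots> = {v \<in> extend_by_zero f ` free_module (basis F 0). v (f e) \<in> I}"
      using f by (auto simp: extend_by_zero_def)
    finally show ?thesis by (simp only: basis_relabel free_module_relabel(1)[OF f])
  qed
  moreover have "differential (relabel f F) (Suc i) ` free_module (basis (relabel f F) (Suc (Suc i))) =
        {v \<in> free_module (basis (relabel f F) (Suc i)). differential (relabel f F) i v = (\<lambda>_. 0)}" for i
  proof -
    have "differential (relabel f F) (Suc i) ` free_module (basis (relabel f F) (Suc (Suc i))) =
        extend_by_zero f ` {v \<in> free_module (basis F (Suc i)). differential F i v = (\<lambda>_. 0)}"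
      by (simp only: basis_relabel relabel_image_differential[OF f] exact)
    also have "\<dots> = {v \<in> extend_by_zero f ` free_module (basis F (Suc i)).
        differential (relabel f F) i v = (\<lambda>_. 0)}"
      by (auto simp: differential_relabel[OF f] free_module_relabel(4)[OF f] extend_by_zero_eq_0_iff[OF f])
    finally show ?thesis by (simp only: basis_relabel free_module_relabel(1)[OF f])
  qed
  ultimately have "graded_free_resolution (relabel f F) I"
    using gr unfolding graded_free_resolution_def by blast
  moreover have "differential (relabel f F) i v c \<in> irrelevant_ideal"
    if v: "v \<in> free_module (basis (relabel f F) (Suc i))" for i v c
  proof -
    have "differential F i (v \<circ> f) b \<in> irrelevant_ideal" for b
      using minimal[OF free_module_relabel(2)[OF f v[unfolded basis_relabel]]] .
    then show ?thesis
      by (simp add: differential_relabel[OF f] extend_by_zero_def) (simp add: irrelevant_ideal_def)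
  qed
  ultimately show ?thesis unfolding minimal_graded_free_resolution_def by blast
qed

text \<open>Betti numbers are defined with bases labelled by natural numbers. A minimal resolution with other
  labels therefore has to be transported along an injection into \<open>nat\<close>, which shows that the definite
  description is satisfied; uniqueness is the comparison of ranks in both directions.\<close>

lemma betti_number_eq:
  fixes F :: "('b::finite, 'v, 'k::field) free_complex"
  assumes F: "minimal_graded_free_resolution F I"
  shows "betti_number I i = card (basis F i)"
proof -
  obtain f :: "'b \<Rightarrow> nat" where f: "inj f"
    using finite_imp_inj_to_nat_seg[of "UNIV :: 'b set"] by blast
  have F': "graded_free_resolution F I"
    using F by (simp add: minimal_graded_free_resolution_def)
  show ?thesis
    unfolding betti_number_def
  proof (rule the_equality)
    have "card (basis (relabel f F) i) = card (basis F i)"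
      using f by (simp add: card_image inj_on_subset[OF f])
    then show "\<exists>G :: (nat, 'v, 'k) free_complex. minimal_graded_free_resolution G I \<and> card (basis G i) = card (basis F i)"
      using minimal_graded_free_resolution_relabel[OF f F] by blast
  next
    fix r assume "\<exists>G :: (nat, 'v, 'k) free_complex. minimal_graded_free_resolution G I \<and> card (basis G i) = r"
    then obtain G :: "(nat, 'v, 'k) free_complex"
      where G: "minimal_graded_free_resolution G I" "card (basis G i) = r" by blast
    then have G': "graded_free_resolution G I" by (simp add: minimal_graded_free_resolution_def)
    show "r = card (basis F i)"
      using minimal_resolution_rank_le[OF F G', of i] minimal_resolution_rank_le[OF G(1) F', of i] G(2) by simp
  qed
qed

section \<open>The Koszul complex\<close>

definition koszul_sign :: "'n::{finite,linorder} \<Rightarrow> 'n set \<Rightarrow> 'a::comm_ring_1" where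
  "koszul_sign s T = (-1) ^ card {t\<in>T. t < s}"

text \<open>The Koszul differential acting on all homological degrees at once. The coefficient at \<open>e\<^sub>T\<close> collects
  the contributions of those \<open>e\<^sub>S\<close> whose differential involves \<open>e\<^sub>T\<close>, namely of \<open>S = T \<union> {s}\<close> with
  \<open>s \<notin> T\<close>.\<close>

definition koszul_diff ::
  "('n::{finite,linorder} \<Rightarrow> 'a::comm_ring_1) \<Rightarrow> ('n set \<Rightarrow> 'a) \<Rightarrow> 'n set \<Rightarrow> 'a" where
  "koszul_diff g v T = (\<Sum>s\<in>-T. koszul_sign s T * g s * v (insert s T))"

lemma koszul_sign_insert:
  assumes "r \<notin> T"
  shows "koszul_sign s (insert r T) = (if r < s then - koszul_sign s T else (koszul_sign s T :: 'a::comm_ring_1))"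
proof -
  have "{t\<in>insert r T. t < s} = (if r < s then insert r {t\<in>T. t < s} else {t\<in>T. t < s})"
    by auto
  then show ?thesis using assms by (simp add: koszul_sign_def)
qed

lemma koszul_sign_below [simp]: "(\<And>t. t \<in> T \<Longrightarrow> s \<le> t) \<Longrightarrow> koszul_sign s T = 1"
proof -
  assume "\<And>t. t \<in> T \<Longrightarrow> s \<le> t"
  then have "{t\<in>T. t < s} = {}" by (auto simp: not_less)
  then show ?thesis by (simp only: koszul_sign_def card.empty power_0)
qed

text \<open>Two elements \<open>s \<noteq> r\<close> can be removed in either order, and the two orders contribute with opposite
  signs.\<close>

lemma koszul_diff_squared: "koszul_diff g (koszul_diff g v) T = (0 :: 'a::comm_ring_1)"
proof -
  define f where "f = (\<lambda>(s, r). koszul_sign s T * g s *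
    (koszul_sign r (insert s T) * g r * v (insert r (insert s T))))"
  define A where "A = {(s, r). s \<notin> T \<and> r \<notin> T \<and> s < r}"
  define B where "B = {(s, r). s \<notin> T \<and> r \<notin> T \<and> r < s}"
  have fin: "finite A" "finite B" by (rule finite)+
  have AB: "(SIGMA s:-T. - insert s T) = A \<union> B" "A \<inter> B = {}"
    by (auto simp: A_def B_def)
  have "koszul_diff g (koszul_diff g v) T = (\<Sum>s\<in>-T. \<Sum>r\<in>-insert s T. f (s, r))"
    by (simp add: koszul_diff_def f_def sum_distrib_left)
  also have "\<dots> = sum f (A \<union> B)"
    by (subst sum.Sigma) (auto simp: AB[symmetric])
  also have "\<dots> = sum f A + sum f B"
    using fin AB by (simp add: sum.union_disjoint)
  finally have sum: "koszul_diff g (koszul_diff g v) T = sum f A + sum f B" .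
  have "sum f B = (\<Sum>p\<in>A. f (prod.swap p))"
    by (rule sum.reindex_bij_witness[of _ prod.swap prod.swap]) (auto simp: A_def B_def)
  also have "\<dots> = (\<Sum>p\<in>A. - f p)"
  proof (rule sum.cong)
    fix p assume "p \<in> A"
    then obtain s r where p: "p = (s, r)" "s \<notin> T" "r \<notin> T" "s < r"
      by (auto simp: A_def)
    \<comment> \<open>Only the larger of the two elements notices the presence of the other one.\<close>
    have e1: "koszul_sign r (insert s T) = (- koszul_sign r T :: 'a)"
      using p by (simp add: koszul_sign_insert)
    have e2: "koszul_sign s (insert r T) = (koszul_sign s T :: 'a)"
      using p(2,3) less_asym[OF p(4)] by (subst koszul_sign_insert) auto
    have e3: "insert r (insert s T) = insert s (insert r T)" by blast
    show "f (prod.swap p) = - f p"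
      by (simp only: f_def p(1) swap_simp prod.case e1 e2 e3 mult_minus_left mult_minus_right minus_minus)
        (simp only: mult_ac)
  qed simp
  also have "\<dots> = - sum f A" by (rule sum_negf)
  finally show ?thesis using sum by simp
qed

lemma koszul_diff_add_left: "koszul_diff (\<lambda>s. f s + g s) v T = koszul_diff f v T + koszul_diff g v T"
  by (simp add: koszul_diff_def sum.distrib distrib_left distrib_right)

lemma koszul_diff_add: "koszul_diff g (u + v) T = koszul_diff g u T + koszul_diff g v T"
  by (simp add: koszul_diff_def sum.distrib distrib_left)

lemma koszul_diff_minus: "koszul_diff g (u - v) T = koszul_diff g u T - koszul_diff g v T"
  by (simp add: koszul_diff_def sum_subtractf right_diff_distrib)

lemma koszul_diff_free:
  fixes g :: "'n::{finite,linorder} \<Rightarrow> 'a::comm_ring_1"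
  assumes "v \<in> free_module {S. card S = Suc p}"
  shows "koszul_diff g v \<in> free_module {S. card S = p}"
  unfolding free_module_def koszul_diff_def
proof (intro CollectI allI impI sum.neutral ballI)
  fix T s assume "(T :: 'n set) \<notin> {S. card S = p}" "s \<in> - T"
  then have "card (insert s T) \<noteq> Suc p" by simp
  then show "koszul_sign s T * g s * v (insert s T) = 0"
    using assms by (simp add: free_module_def)
qed

text \<open>Both sides sum over the pairs \<open>(S, s)\<close> with \<open>s \<in> S\<close> and \<open>T = S - {s}\<close>, which are determined by
  \<open>s \<notin> T\<close>. The sign is the same for \<open>S\<close> and \<open>T\<close>, as \<open>s\<close> is not below itself.\<close>

lemma differential_koszul_complex:
  assumes v: "v \<in> free_module {S. card S = Suc p}"
  shows "differential (koszul_complex d g) p v = koszul_diff g v"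
proof
  fix T
  show "differential (koszul_complex d g) p v T = koszul_diff g v T"
  proof (cases "card T = p")
    case False
    then show ?thesis
      using koszul_diff_free[OF v, of g] by (simp add: differential_def koszul_complex_def free_module_def)
  next
    case True
    have "differential (koszul_complex d g) p v T =
      (\<Sum>S\<in>{S. card S = Suc p}. \<Sum>s\<in>S. if T = S - {s} then koszul_sign s S * g s * v S else 0)"
      using True by (simp add: differential_def koszul_complex_def koszul_sign_def sum_distrib_right
          if_distrib[of "\<lambda>z. z * v S" for S] cong: sum.cong if_cong)
    also have "\<dots> = (\<Sum>(S, s)\<in>(SIGMA S:{S. card S = Suc p}. S). if T = S - {s} then koszul_sign s S * g s * v S else 0)"
      by (subst sum.Sigma) auto
    also have "\<dots> = (\<Sum>(S, s)\<in>{(S, s). card S = Suc p \<and> s \<in> S \<and> T = S - {s}}. koszul_sign s S * g s * v S)"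
    proof (rule sum.mono_neutral_cong_right, goal_cases)
      case 2
      show ?case by blast
    next
      case 3
      show ?case
      proof (intro ballI)
        fix q
        assume "q \<in> (SIGMA S:{S. card S = Suc p}. S) - {(S, s). card S = Suc p \<and> s \<in> S \<and> T = S - {s}}"
        then show "(case q of (S, s) \<Rightarrow> if T = S - {s} then koszul_sign s S * g s * v S else 0) = 0"
          by (cases q) simp
      qed
    next
      case (4 x)
      then show ?case by (simp add: split_beta)
    qed simp
    also have "\<dots> = koszul_diff g v T"
    proof -
      have "{(S, s). card S = Suc p \<and> s \<in> S \<and> T = S - {s}} = (\<lambda>s. (insert s T, s)) ` (- T)"
      proof (intro set_eqI iffI)
        fix q assume "q \<in> {(S, s). card S = Suc p \<and> s \<in> S \<and> T = S - {s}}"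
        then obtain S s where q: "q = (S, s)" "s \<in> S" "T = S - {s}" by blast
        then have "S = insert s T" "s \<notin> T" by blast+
        then show "q \<in> (\<lambda>s. (insert s T, s)) ` (- T)" using q(1) by blast
      next
        fix q assume "q \<in> (\<lambda>s. (insert s T, s)) ` (- T)"
        then obtain s where "q = (insert s T, s)" "s \<notin> T" by blast
        then show "q \<in> {(S, s). card S = Suc p \<and> s \<in> S \<and> T = S - {s}}" using True by simp
      qed
      moreover have "inj_on (\<lambda>s. (insert s T, s)) (- T)" by (rule inj_onI) simp
      ultimately show ?thesis
        by (simp add: sum.reindex koszul_diff_def koszul_sign_insert)
    qed
    finally show ?thesis .
  qed
qed

text \<open>Coefficients are indexed by the labels \<open>s\<close> and not by the generators, as \<open>g\<close> need not be injective.
  In this form the ideal is the image of the first Koszul differential.\<close>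

lemma ideal_generated_range:
  fixes g :: "'n::finite \<Rightarrow> 'a::comm_ring_1"
  shows "ideal_generated (range g) = range (\<lambda>u. \<Sum>s\<in>UNIV. g s * u s)"
proof
  let ?J = "range (\<lambda>u. \<Sum>s\<in>UNIV. g s * u s)"
  have "ring_as_module.subspace ?J"
  proof (rule ring_as_module.subspaceI)
    show "0 \<in> ?J" by (rule image_eqI[of _ _ "\<lambda>_. 0"]) simp_all
    show "x + y \<in> ?J" if x: "x \<in> ?J" and y: "y \<in> ?J" for x y
    proof -
      obtain u v where "x = (\<Sum>s\<in>UNIV. g s * u s)" "y = (\<Sum>s\<in>UNIV. g s * v s)" using x y by blast
      then show ?thesis
        by (intro image_eqI[of _ _ "\<lambda>s. u s + v s"]) (simp_all add: distrib_left sum.distrib)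
    qed
    show "r * x \<in> ?J" if x: "x \<in> ?J" for r x
    proof -
      obtain u where "x = (\<Sum>s\<in>UNIV. g s * u s)" using x by blast
      then show ?thesis
        by (intro image_eqI[of _ _ "\<lambda>s. r * u s"])
          (simp_all only: sum_distrib_left mult.left_commute[of _ r] UNIV_I)
    qed
  qed
  moreover have "range g \<subseteq> ?J"
  proof (rule image_subsetI)
    fix t
    show "g t \<in> ?J"
      by (rule image_eqI[of _ _ "\<lambda>s. if s = t then 1 else 0"]) (simp_all add: if_distrib cong: if_cong)
  qed
  ultimately show "ideal_generated (range g) \<subseteq> ?J"
    by (rule ring_as_module.span_minimal[rotated])
  have "(\<Sum>s\<in>UNIV. g s * u s) \<in> ideal_generated (range g)" for u
  proof (rule ring_as_module.span_sum)
    fix s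
    have "u s * g s \<in> ideal_generated (range g)"
      by (intro ring_as_module.span_scale ring_as_module.span_base rangeI)
    then show "g s * u s \<in> ideal_generated (range g)" by (simp only: mult.commute)
  qed
  then show "?J \<subseteq> ideal_generated (range g)" by blast
qed

lemma graded_free_koszul_complex:
  assumes "\<And>i. homogeneous (d i) (g i)"
  shows "graded_free (koszul_complex d g)"
  unfolding graded_free_def
proof (intro conjI allI ballI)
  fix p T S
  show "homogeneous (shift (koszul_complex d g) (Suc p) S - shift (koszul_complex d g) p T)
      (diff_matrix (koszul_complex d g) p T S)"
    unfolding homogeneous_def
  proof
    fix m assume "m \<in> Poly_Mapping.keys (diff_matrix (koszul_complex d g) p T S)"
    then obtain s where s: "s \<in> S" "m \<in> Poly_Mapping.keys
        (if T = S - {s} then (-1) ^ card {t\<in>S. t < s} * g s else 0)"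
      using keys_sum[of "\<lambda>s. if T = S - {s} then (-1) ^ card {t\<in>S. t < s} * g s else 0" S]
      by (auto simp: koszul_complex_def)
    then have T: "T = S - {s}" and m: "m \<in> Poly_Mapping.keys ((-1) ^ card {t\<in>S. t < s} * g s)"
      by (auto split: if_splits)
    have "(-1) ^ card {t\<in>S. t < s} * g s = g s \<or> (-1) ^ card {t\<in>S. t < s} * g s = - g s"
      by (cases "even (card {t\<in>S. t < s})") simp_all
    then have "m \<in> Poly_Mapping.keys (g s)" using m by (auto simp: in_keys_iff)
    moreover have "(\<Sum>s\<in>S. d s) = d s + (\<Sum>s\<in>T. d s)"
      unfolding T by (rule sum.remove[OF _ s(1)]) simp
    ultimately show "int (monomial_degree m) =
        shift (koszul_complex d g) (Suc p) S - shift (koszul_complex d g) p T"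
      using assms[of s] by (simp add: koszul_complex_def homogeneous_def)
  qed
qed simp

lemma koszul_diff_empty: "koszul_diff g v {} = (\<Sum>s\<in>UNIV. g s * v {s})"
  by (simp add: koszul_diff_def koszul_sign_def)

text \<open>In degree 0 the image of the differential is the ideal generated by the \<open>g i\<close>, so that exactness
  in positive degrees is all that a resolution needs. The nonzero entries of the differentials
  are \<open>\<plusminus> g i\<close>, so that the resolution is minimal.\<close>

lemma koszul_complex_minimal_resolution:
  fixes g :: "'n::{finite,linorder} \<Rightarrow> ('v, 'k::comm_ring_1) mpoly"
  assumes hom: "\<And>i. homogeneous (d i) (g i)" and irr: "\<And>i. g i \<in> irrelevant_ideal"
    and exact: "\<And>p v. v \<in> free_module {S. card S = Suc p} \<Longrightarrow> koszul_diff g v = (\<lambda>_. 0) \<Longrightarrow>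
      \<exists>u\<in>free_module {S. card S = Suc (Suc p)}. koszul_diff g u = v"
  shows "minimal_graded_free_resolution (koszul_complex d g) (ideal_generated (range g))"
proof -
  let ?K = "koszul_complex d g"
  have basis: "basis ?K p = {S. card S = p}" for p by (simp add: koszul_complex_def)
  have basis0: "basis ?K 0 = {{}}" by (auto simp: basis)
  have image: "differential ?K p ` free_module {S. card S = Suc p} = koszul_diff g ` free_module {S. card S = Suc p}" for p
    by (rule image_cong[OF refl differential_koszul_complex])
  have exact0: "differential ?K 0 ` free_module (basis ?K 1) =
      {v \<in> free_module (basis ?K 0). v {} \<in> ideal_generated (range g)}"
  proof -
    have "koszul_diff g ` free_module {S. card S = Suc 0} =
      {v \<in> free_module {{}}. v {} \<in> range (\<lambda>u. \<Sum>s\<in>UNIV. g s * u s)}" (is "?A = ?B")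
    proof (intro equalityI subsetI)
      fix w assume "w \<in> ?A"
      then obtain v where v: "v \<in> free_module {S. card S = Suc 0}" "w = koszul_diff g v" by blast
      have "w \<in> free_module {S. card S = 0}" using koszul_diff_free[OF v(1)] v(2) by simp
      moreover have "{S :: 'n set. card S = 0} = {{}}" by auto
      moreover have "w {} \<in> range (\<lambda>u. \<Sum>s\<in>UNIV. g s * u s)"
        unfolding v(2) koszul_diff_empty by (rule range_eqI) (rule refl)
      ultimately show "w \<in> ?B" by simp
    next
      fix w assume "w \<in> ?B"
      then obtain u where w: "w \<in> free_module {{}}" and u: "w {} = (\<Sum>s\<in>UNIV. g s * u s)" by blast
      define v where "v S = (if card S = Suc 0 then u (the_elem S) else 0)" for S :: "'n set"
      have v: "v \<in> free_module {S. card S = Suc 0}" by (simp add: v_def free_module_def)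
      have "koszul_diff g v = w"
      proof
        fix S
        show "koszul_diff g v S = w S"
        proof (cases "S = {}")
          case True
          then show ?thesis by (simp add: koszul_diff_empty u v_def)
        next
          case False
          then have "card S \<noteq> 0" by simp
          then show ?thesis
            using koszul_diff_free[OF v, of g] w False by (simp add: free_module_def)
        qed
      qed
      then show "w \<in> ?A" using v by blast
    qed
    then show ?thesis
      unfolding ideal_generated_range basis0 using image[of 0] by (simp add: basis)
  qed
  have exactS: "differential ?K (Suc p) ` free_module (basis ?K (Suc (Suc p))) =
      {v \<in> free_module (basis ?K (Suc p)). differential ?K p v = (\<lambda>_. 0)}" for p
  proof -
    have "koszul_diff g ` free_module {S. card S = Suc (Suc p)} =
      {v \<in> free_module {S. card S = Suc p}. koszul_diff g v = (\<lambda>_. 0)}" (is "?A = ?B")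
    proof (intro equalityI subsetI)
      fix w assume "w \<in> ?A"
      then obtain v where v: "v \<in> free_module {S. card S = Suc (Suc p)}" "w = koszul_diff g v" by blast
      then show "w \<in> ?B" using koszul_diff_free[OF v(1), of g] koszul_diff_squared[of g v] by auto
    next
      fix w assume "w \<in> ?B"
      then show "w \<in> ?A" using exact[of w p] by blast
    qed
    also have "?B = {v \<in> free_module {S. card S = Suc p}. differential ?K p v = (\<lambda>_. 0)}"
      by (rule Collect_cong) (auto simp: differential_koszul_complex)
    finally show ?thesis unfolding basis image .
  qed
  have "graded_free_resolution ?K (ideal_generated (range g))"
    unfolding graded_free_resolution_def
  proof (intro conjI allI exI)
    show "shift ?K 0 {} = 0" by (simp add: koszul_complex_def)
  qed (rule graded_free_koszul_complex[OF hom] basis0 exact0 exactS)+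
  moreover have "differential ?K p v T \<in> irrelevant_ideal"
    if v: "v \<in> free_module (basis ?K (Suc p))" for p v T
    unfolding differential_koszul_complex[OF v[unfolded basis]] koszul_diff_def
    using irr by (intro irrelevant_ideal_sum) (simp add: irrelevant_ideal_def lookup_times_zero)
  ultimately show ?thesis unfolding minimal_graded_free_resolution_def by blast
qed

section \<open>Exactness for pairwise coprime leading monomials\<close>

text \<open>The polynomials in question are the sums of the monomial \<open>m i\<close> and the tail \<open>c i\<close>, so that
  \<open>m i\<close> is their form of highest weight.\<close>

locale coprime_leading_monomials =
  fixes m :: "'n::{finite,linorder} \<Rightarrow> ('v \<Rightarrow>\<^sub>0 nat)"
    and c :: "'n \<Rightarrow> ('v, 'k::comm_ring_1) mpoly"
    and wt :: "('v \<Rightarrow>\<^sub>0 nat) \<Rightarrow> nat"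
  assumes coprime: "i \<noteq> j \<Longrightarrow> Poly_Mapping.keys (m i) \<inter> Poly_Mapping.keys (m j) = {}"
    and wt_add: "wt (a + b) = wt a + wt b"
    and wt_less: "a \<in> Poly_Mapping.keys (c i) \<Longrightarrow> wt a < wt (m i)"
begin

abbreviation lead :: "'n \<Rightarrow> ('v, 'k) mpoly" where
  "lead i \<equiv> Poly_Mapping.single (m i) 1"

definition divisors :: "('v \<Rightarrow>\<^sub>0 nat) \<Rightarrow> 'n set" where
  "divisors b = {i. monomial_dvd (m i) b}"

lemma coprime_cases: "i \<noteq> j \<Longrightarrow> Poly_Mapping.lookup (m i) v = 0 \<or> Poly_Mapping.lookup (m j) v = 0"
  using coprime[of i j] by (auto simp: in_keys_iff)

lemma divisors_add: "divisors (b + m t) = insert t (divisors b)"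
proof -
  have *: "monomial_dvd (m i) (b + m t) \<longleftrightarrow> monomial_dvd (m i) b" if "i \<noteq> t" for i
    using coprime_cases[OF that]
    by (simp add: monomial_dvd_def lookup_add) (metis add.right_neutral le0)
  have "monomial_dvd (m t) (b + m t)"
    by (simp add: monomial_dvd_def lookup_add)
  then show ?thesis
    using * unfolding divisors_def by (intro set_eqI) (metis (mono_tags) insert_iff mem_Collect_eq)
qed

lemma divisors_diff:
  assumes "s \<in> divisors b" shows "insert s (divisors (b - m s)) = divisors b"
  using divisors_add[of "b - m s" s] assms monomial_dvd_add_diff[of "m s" b]
  by (simp add: divisors_def add.commute)

text \<open>Extracts the monomials divisible by \<open>m t\<close> and divides them by \<open>m t\<close>, but keeps only those quotients
  that are not divisible by any \<open>m i\<close> with \<open>i < t\<close>.\<close>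

definition divide_lead :: "'n \<Rightarrow> ('v, 'k) mpoly \<Rightarrow> ('v, 'k) mpoly" where
  "divide_lead t p = Poly_Mapping.mapp (\<lambda>b a. a when (\<forall>i\<in>divisors b. t \<le> i))
     (Poly_Mapping.map_key (\<lambda>b. b + m t) p)"

lemma lookup_divide_lead:
  "Poly_Mapping.lookup (divide_lead t p) b =
    (if \<forall>i\<in>divisors b. t \<le> i then Poly_Mapping.lookup p (b + m t) else 0)"
proof -
  have inj: "inj (\<lambda>b. b + m t)" by (simp add: inj_on_def)
  have "Poly_Mapping.lookup (Poly_Mapping.map_key (\<lambda>b. b + m t) p) b = Poly_Mapping.lookup p (b + m t)"
    by (simp add: map_key.rep_eq[OF inj])
  then show ?thesis
    by (auto simp: divide_lead_def lookup_mapp when_def in_keys_iff)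
qed

text \<open>The basis elements \<open>x\<^sup>b e\<^sub>S\<close> of a fixed multidegree, where \<open>e\<^sub>S\<close> has the multidegree of
  \<open>\<Prod>s\<in>S. m s\<close>, correspond to the faces \<open>S\<close> of the simplex with vertex set \<open>S \<union> divisors b\<close>: by
  coprimality this set is the same for all of them. The homotopy adds the smallest vertex \<open>t\<close> to a face
  not containing it. Seen from the target \<open>x\<^sup>b e\<^sub>S\<close>, the vertex \<open>t\<close> has to be the smallest element of
  \<open>S\<close>, no smaller \<open>i\<close> may lie in \<open>divisors b\<close>, and the coefficient is the one at
  \<open>x\<^sup>b m\<^sub>t\<close> for the face \<open>S - {t}\<close>. Since \<open>t\<close> comes first, no sign occurs.\<close>

definition homotopy :: "('n set \<Rightarrow> ('v, 'k) mpoly) \<Rightarrow> 'n set \<Rightarrow> ('v, 'k) mpoly" where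
  "homotopy v S = (if S = {} then 0 else divide_lead (Min S) (v (S - {Min S})))"

lemma lookup_homotopy:
  "Poly_Mapping.lookup (homotopy v S) b =
    (if S \<noteq> {} \<and> (\<forall>i\<in>divisors b. Min S \<le> i)
     then Poly_Mapping.lookup (v (S - {Min S})) (b + m (Min S)) else 0)"
  by (simp add: homotopy_def lookup_divide_lead)

lemma homotopy_minus: "homotopy (- v) = - homotopy v"
  by (rule ext, rule poly_mapping_eqI) (simp add: lookup_homotopy)

lemma homotopy_free:
  assumes "v \<in> free_module {S. card S = p}"
  shows "homotopy v \<in> free_module {S. card S = Suc p}"
  unfolding free_module_def
proof (intro CollectI allI impI)
  fix S :: "'n set" assume S: "S \<notin> {S. card S = Suc p}"
  have "v (S - {Min S}) = 0" if "S \<noteq> {}"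
  proof -
    have "Suc (card (S - {Min S})) = card S"
      using that by (intro card_Suc_Diff1) auto
    then show ?thesis using S assms by (auto simp: free_module_def)
  qed
  then show "homotopy v S = 0"
    by (intro poly_mapping_eqI) (auto simp: lookup_homotopy)
qed

lemma lookup_koszul_diff_lead:
  "Poly_Mapping.lookup (koszul_diff lead v S) b =
    (\<Sum>s\<in>divisors b - S. koszul_sign s S * Poly_Mapping.lookup (v (insert s S)) (b - m s))"
proof -
  have sgn: "Poly_Mapping.lookup (koszul_sign s S * q) b = koszul_sign s S * Poly_Mapping.lookup q b"
    for s and q :: "('v, 'k) mpoly"
    by (cases "even (card {t\<in>S. t < s})") (simp_all add: koszul_sign_def)
  have "Poly_Mapping.lookup (koszul_diff lead v S) b =
    (\<Sum>s\<in>-S. koszul_sign s S * (if s \<in> divisors b then Poly_Mapping.lookup (v (insert s S)) (b - m s) else 0))"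
    by (simp only: koszul_diff_def lookup_sum mult.assoc sgn lookup_monomial_mult divisors_def mem_Collect_eq)
  also have "\<dots> = (\<Sum>s\<in>divisors b - S. koszul_sign s S * Poly_Mapping.lookup (v (insert s S)) (b - m s))"
    by (rule sum.mono_neutral_cong_right) auto
  finally show ?thesis .
qed

text \<open>The simplex attached to a basis element \<open>x\<^sup>b e\<^sub>S\<close> is a cone with its smallest vertex \<open>t\<close> as apex. If
  \<open>t \<in> S\<close>, then removing \<open>t\<close> again accounts for \<open>v S\<close>, while the terms for the other vertices cancel
  between the two summands. If \<open>t \<notin> S\<close>, then only the term adding \<open>t\<close> survives. The simplex has no
  vertex only if \<open>S = {}\<close>, where \<open>v\<close> vanishes by assumption.\<close>

lemma homotopy_identity:
  assumes v0: "v {} = 0"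
  shows "koszul_diff lead (homotopy v) S + homotopy (koszul_diff lead v) S = v S"
proof (rule poly_mapping_eqI)
  fix b
  have goal: "Poly_Mapping.lookup (koszul_diff lead (homotopy v) S) b +
      Poly_Mapping.lookup (homotopy (koszul_diff lead v) S) b = Poly_Mapping.lookup (v S) b"
  proof (cases "S \<union> divisors b = {}")
    case True
    then show ?thesis using v0 by (simp add: lookup_koszul_diff_lead lookup_homotopy)
  next
    case False
    \<comment> \<open>The apex of the cone.\<close>
    define t where "t = Min (S \<union> divisors b)"
    have tin: "t \<in> S \<union> divisors b"
      unfolding t_def using False by (intro Min_in finite)
    have tle: "t \<le> i" if "i \<in> S \<union> divisors b" for i
      unfolding t_def using that by (intro Min_le finite)
    show ?thesis
    proof (cases "t \<in> S")
      case True
      have MinS: "Min S = t" using True tle by (intro Min_eqI) auto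
      have MinI: "Min (insert s S) = t" if "s \<in> divisors b" for s
        using True tle that by (intro Min_eqI) auto
      have sub: "divisors (b - m s) \<subseteq> divisors b" if "s \<in> divisors b" for s
        using divisors_diff[OF that] by auto
      have A: "Poly_Mapping.lookup (koszul_diff lead (homotopy v) S) b =
        (\<Sum>s\<in>divisors b - S. koszul_sign s S * Poly_Mapping.lookup (v (insert s S - {t})) (b - m s + m t))"
        unfolding lookup_koszul_diff_lead
      proof (rule sum.cong, goal_cases)
        case (2 s)
        then have "\<forall>i\<in>divisors (b - m s). t \<le> i" using sub[of s] tle by auto
        then show ?case using 2 MinI[of s] by (simp add: lookup_homotopy)
      qed simp
      have dec: "divisors (b + m t) - (S - {t}) = insert t (divisors b - S)"
        using True by (auto simp: divisors_add)
      have "Poly_Mapping.lookup (homotopy (koszul_diff lead v) S) b =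
        Poly_Mapping.lookup (koszul_diff lead v (S - {t})) (b + m t)"
        using True tle MinS by (auto simp: lookup_homotopy)
      also have "\<dots> = (\<Sum>s\<in>insert t (divisors b - S).
          koszul_sign s (S - {t}) * Poly_Mapping.lookup (v (insert s (S - {t}))) (b + m t - m s))"
        by (simp only: lookup_koszul_diff_lead dec)
      also have "\<dots> = koszul_sign t (S - {t}) * Poly_Mapping.lookup (v (insert t (S - {t}))) (b + m t - m t)
        + (\<Sum>s\<in>divisors b - S.
          koszul_sign s (S - {t}) * Poly_Mapping.lookup (v (insert s (S - {t}))) (b + m t - m s))"
        using True by (simp add: sum.insert)
      also have "koszul_sign t (S - {t}) * Poly_Mapping.lookup (v (insert t (S - {t}))) (b + m t - m t)
          = Poly_Mapping.lookup (v S) b"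
      proof -
        have "koszul_sign t (S - {t}) = (1 :: 'k)"
          using tle by (intro koszul_sign_below) auto
        then show ?thesis using True by (simp add: insert_absorb)
      qed
      also have "(\<Sum>s\<in>divisors b - S.
          koszul_sign s (S - {t}) * Poly_Mapping.lookup (v (insert s (S - {t}))) (b + m t - m s))
        = (\<Sum>s\<in>divisors b - S. - (koszul_sign s S * Poly_Mapping.lookup (v (insert s S - {t})) (b - m s + m t)))"
      proof (rule sum.cong, goal_cases)
        case (2 s)
        then have s: "s \<noteq> t" "t < s" using True tle[of s] by (auto simp: less_le)
        have "koszul_sign s S = (- koszul_sign s (S - {t}) :: 'k)"
          using koszul_sign_insert[of t "S - {t}" s] s True by (simp add: insert_absorb)
        moreover have "b + m t - m s = b - m s + m t"
          using 2 coprime_cases[OF s(1)]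
          by (intro poly_mapping_eqI) (auto simp: lookup_add lookup_minus divisors_def monomial_dvd_def)
        moreover have "insert s (S - {t}) = insert s S - {t}" using s by auto
        ultimately show ?case by simp
      qed simp
      finally show ?thesis by (simp add: A sum_negf)
    next
      case False
      then have tD: "t \<in> divisors b" using tin by auto
      have lt: "t < s" if "s \<in> S" for s using that tle[of s] False by (auto simp: less_le)
      \<comment> \<open>The face \<open>S\<close> misses the apex, and the homotopy only reaches faces containing it.\<close>
      have "\<not> Min S \<le> t" if "S \<noteq> {}"
        using lt[OF Min_in[OF finite that]] by (simp only: not_le)
      then have "Poly_Mapping.lookup (homotopy (koszul_diff lead v) S) b = 0"
        using tD by (auto simp: lookup_homotopy)
      moreover have "Poly_Mapping.lookup (koszul_diff lead (homotopy v) S) b = Poly_Mapping.lookup (v S) b"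
      proof -
        have "Poly_Mapping.lookup (koszul_diff lead (homotopy v) S) b =
          (\<Sum>s\<in>divisors b - S. if s = t then Poly_Mapping.lookup (v S) b else 0)"
          unfolding lookup_koszul_diff_lead
        proof (rule sum.cong, goal_cases)
          case (2 s)
          show ?case
          proof (cases "s = t")
            case True
            have "Min (insert t S) = t" using lt by (intro Min_eqI) (auto simp: less_imp_le)
            moreover have "\<forall>i\<in>divisors (b - m t). t \<le> i"
              using divisors_diff[OF tD] tle by auto
            moreover have "koszul_sign t S = (1::'k)" using lt by (simp add: less_imp_le)
            moreover have "b - m t + m t = b"
              using tD monomial_dvd_add_diff[of "m t" b] by (simp add: divisors_def add.commute)
            ultimately show ?thesis using True False by (simp add: lookup_homotopy)
          next
            case neq: False
            have "t < s" using neq 2 tle[of s] by (auto simp: less_le)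
            then have "\<not> Min (insert s S) \<le> t"
              using lt by (auto simp: not_le)
            moreover have "t \<in> divisors (b - m s)"
              using divisors_diff[of s b] tD neq 2 by auto
            ultimately show ?thesis using neq by (auto simp: lookup_homotopy)
          qed
        qed simp
        also have "\<dots> = Poly_Mapping.lookup (v S) b" using tD False by simp
        finally show ?thesis .
      qed
      ultimately show ?thesis by simp
    qed
  qed
  then show "Poly_Mapping.lookup (koszul_diff lead (homotopy v) S + homotopy (koszul_diff lead v) S) b
    = Poly_Mapping.lookup (v S) b" by (simp add: lookup_add)
qed

text \<open>The term \<open>x\<^sup>b e\<^sub>S\<close> has the weight of \<open>b\<close> plus the weights of \<open>m s\<close> for \<open>s \<in> S\<close>. With this choice the
  homotopy preserves weights and the differential formed with the \<open>c i\<close> lowers them.\<close>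

definition filtration :: "nat \<Rightarrow> ('n set \<Rightarrow> ('v, 'k) mpoly) set" where
  "filtration w = {v. \<forall>S. \<forall>b\<in>Poly_Mapping.keys (v S). wt b + (\<Sum>s\<in>S. wt (m s)) < w}"

lemma filtration_homotopy:
  assumes v: "v \<in> filtration w" shows "homotopy v \<in> filtration w"
  unfolding filtration_def
proof (intro CollectI allI ballI)
  fix S b assume b: "b \<in> Poly_Mapping.keys (homotopy v S)"
  then have S: "S \<noteq> {}" and b': "b + m (Min S) \<in> Poly_Mapping.keys (v (S - {Min S}))"
    by (auto simp: in_keys_iff lookup_homotopy split: if_splits)
  have "(\<Sum>s\<in>S. wt (m s)) = wt (m (Min S)) + (\<Sum>s\<in>S - {Min S}. wt (m s))"
    using S by (intro sum.remove) auto
  moreover have "wt (b + m (Min S)) + (\<Sum>s\<in>S - {Min S}. wt (m s)) < w"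
    using v b' by (auto simp: filtration_def)
  ultimately show "wt b + (\<Sum>s\<in>S. wt (m s)) < w" by (simp add: wt_add)
qed

text \<open>The differential removes some \<open>s\<close> from the index set, whereby the weight of \<open>m s\<close> is lost, and
  multiplies by monomials of \<open>c s\<close>, which have smaller weight than \<open>m s\<close>.\<close>

lemma filtration_koszul_diff_tail:
  assumes v: "v \<in> filtration (Suc w)" shows "koszul_diff c v \<in> filtration w"
  unfolding filtration_def
proof (intro CollectI allI ballI)
  fix S b assume b: "b \<in> Poly_Mapping.keys (koszul_diff c v S)"
  then obtain s where s: "s \<notin> S" "b \<in> Poly_Mapping.keys (koszul_sign s S * c s * v (insert s S))"
    using keys_sum[of "\<lambda>s. koszul_sign s S * c s * v (insert s S)" "- S"]
    by (auto simp: koszul_diff_def)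
  have "koszul_sign s S * c s * v (insert s S) = c s * v (insert s S) \<or>
    koszul_sign s S * c s * v (insert s S) = - (c s * v (insert s S))"
    by (cases "even (card {t\<in>S. t < s})") (simp_all add: koszul_sign_def)
  then have "b \<in> Poly_Mapping.keys (c s * v (insert s S))"
    using s(2) by (auto simp: in_keys_iff)
  then obtain a b' where ab: "b = a + b'" "a \<in> Poly_Mapping.keys (c s)" "b' \<in> Poly_Mapping.keys (v (insert s S))"
    using keys_mult[of "c s" "v (insert s S)"] by blast
  have "wt b' + (\<Sum>s\<in>insert s S. wt (m s)) < Suc w"
    using v ab(3) by (auto simp only: filtration_def mem_Collect_eq)
  then show "wt b + (\<Sum>s\<in>S. wt (m s)) < w"
    using wt_less[OF ab(2)] s(1) by (simp add: ab(1) wt_add)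
qed

lemma filtration_minus_diff:
  assumes "u \<in> filtration w" "v \<in> filtration w" shows "- u - v \<in> filtration w"
  unfolding filtration_def
proof (intro CollectI allI ballI)
  fix S b assume "b \<in> Poly_Mapping.keys ((- u - v) S)"
  then have "b \<in> Poly_Mapping.keys (u S) \<or> b \<in> Poly_Mapping.keys (v S)"
    by (auto simp: in_keys_iff lookup_minus)
  then show "wt b + (\<Sum>s\<in>S. wt (m s)) < w"
    using assms by (auto simp: filtration_def)
qed

lemma filtration_exhaustive: "\<exists>w. v \<in> filtration w"
proof -
  have fin: "finite (\<Union>S\<in>UNIV. (\<lambda>b. wt b + (\<Sum>s\<in>S. wt (m s))) ` Poly_Mapping.keys (v S))"
    by (rule finite_UN_I) auto
  then obtain w where "\<forall>a\<in>(\<Union>S\<in>UNIV. (\<lambda>b. wt b + (\<Sum>s\<in>S. wt (m s))) ` Poly_Mapping.keys (v S)). a < w"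
    by (meson finite_nat_set_iff_bounded)
  then show ?thesis by (auto simp: filtration_def intro!: exI[of _ w])
qed

text \<open>Induction on a bound for the weights of a cycle \<open>v\<close>. Let \<open>d = d\<^sub>1 + d\<^sub>0\<close> be the decomposition of the
  differential belonging to \<open>g = lead + c\<close>, and \<open>h\<close> the homotopy for \<open>d\<^sub>1\<close>. From \<open>d v = 0\<close> one has
  \<open>d\<^sub>1 v = - d\<^sub>0 v\<close>, so that
  \<open>v - d (h v) = h (d\<^sub>1 v) - d\<^sub>0 (h v) = - h (d\<^sub>0 v) - d\<^sub>0 (h v)\<close>, which is again a cycle and has smaller
  weight.\<close>

lemma koszul_exact:
  assumes "v \<in> free_module {S. card S = Suc p}" "koszul_diff (\<lambda>i. lead i + c i) v = (\<lambda>_. 0)"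
  shows "\<exists>u\<in>free_module {S. card S = Suc (Suc p)}. koszul_diff (\<lambda>i. lead i + c i) u = v"
proof -
  let ?g = "\<lambda>i. lead i + c i"
  obtain w where "v \<in> filtration w" using filtration_exhaustive by blast
  then show ?thesis using assms
  proof (induction w arbitrary: v)
    case 0
    then have "v = (\<lambda>_. 0)"
      by (auto simp: filtration_def fun_eq_iff)
    then show ?case
      by (intro bexI[of _ "\<lambda>_. 0"]) (auto simp: koszul_diff_def free_module_def fun_eq_iff)
  next
    case (Suc w)
    define v' where "v' = v - koszul_diff ?g (homotopy v)"
    have v0: "v {} = 0" using Suc.prems(2) by (simp add: free_module_def)
    have "koszul_diff lead v = - koszul_diff c v"
    proof
      fix S
      show "koszul_diff lead v S = (- koszul_diff c v) S"
        using fun_cong[OF Suc.prems(3), of S] by (simp add: koszul_diff_add_left eq_neg_iff_add_eq_0)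
    qed
    then have *: "homotopy (koszul_diff lead v) = - homotopy (koszul_diff c v)"
      by (simp add: homotopy_minus)
    have "v' = - homotopy (koszul_diff c v) - koszul_diff c (homotopy v)"
    proof
      fix S
      show "v' S = (- homotopy (koszul_diff c v) - koszul_diff c (homotopy v)) S"
        using homotopy_identity[of v S, OF v0] *
        by (simp add: v'_def koszul_diff_add_left algebra_simps)
    qed
    then have 1: "v' \<in> filtration w"
      using Suc.prems(1)
      by (simp add: filtration_minus_diff filtration_homotopy filtration_koszul_diff_tail)
    have h: "homotopy v \<in> free_module {S. card S = Suc (Suc p)}"
      by (rule homotopy_free[OF Suc.prems(2)])
    have 2: "v' \<in> free_module {S. card S = Suc p}"
      unfolding v'_def by (intro free_module_diff Suc.prems koszul_diff_free h)
    have 3: "koszul_diff ?g v' = (\<lambda>_. 0)"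
      by (rule ext) (use Suc.prems(3) in \<open>simp add: v'_def koszul_diff_minus koszul_diff_squared\<close>)
    obtain u where u: "u \<in> free_module {S. card S = Suc (Suc p)}" "koszul_diff ?g u = v'"
      using Suc.IH[OF 1 2 3] by blast
    have "koszul_diff ?g (u + homotopy v) = v"
      by (rule ext) (simp add: koszul_diff_add u v'_def)
    moreover have "u + homotopy v \<in> free_module {S. card S = Suc (Suc p)}"
      using u(1) h by (simp add: free_module_def)
    ultimately show ?case by blast
  qed
qed

end

section \<open>Generic and generic symmetric matrices\<close>

lemma monomial_degree_add: "monomial_degree (a + b) = monomial_degree a + monomial_degree b"
proof -
  have *: "monomial_degree c = (\<Sum>v\<in>Poly_Mapping.keys a \<union> Poly_Mapping.keys b. Poly_Mapping.lookup c v)"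
    if "Poly_Mapping.keys c \<subseteq> Poly_Mapping.keys a \<union> Poly_Mapping.keys b" for c
    unfolding monomial_degree_def using that
    by (intro sum.mono_neutral_left) (auto simp: in_keys_iff)
  show ?thesis
    by (simp add: * keys_add lookup_add sum.distrib)
qed

lemma monomial_degree_single [simp]: "monomial_degree (Poly_Mapping.single v k) = k"
  by (simp add: monomial_degree_def)

lemma indet_mult_indet:
  "indet u * indet v = Poly_Mapping.single (Poly_Mapping.single u 1 + Poly_Mapping.single v 1) 1"
  by (simp add: indet_def mult_single)

text \<open>Common to both kinds of matrices. In a generic symmetric matrix an indeterminate can occur twice, but
  only at the places \<open>(i, j)\<close> and \<open>(j, i)\<close>; so those on the diagonal still occur once.\<close>

lemma generic_cases:
  assumes "generic x y \<or> generic_symmetric x y"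
  shows "inj y" and "x i i \<noteq> y j" and "x i j = x k k \<longleftrightarrow> i = k \<and> j = k"
proof -
  let ?f = "case_sum (\<lambda>(i, j). x i j) y"
  \<comment> \<open>\<open>D\<close> consists of the places of \<open>X\<close> whose entries name the indeterminates: all places if \<open>X\<close> is
    generic, those on or above the diagonal if it is symmetric.\<close>
  have "\<exists>D. inj_on ?f (D <+> UNIV) \<and> (\<forall>i j. \<exists>i' j'. (i', j') \<in> D \<and> x i' j' = x i j \<and> {i', j'} = {i, j})"
    using assms
  proof
    assume "generic x y"
    then show ?thesis
      unfolding generic_def bij_betw_def by (intro exI[of _ UNIV]) (auto simp: UNIV_Plus_UNIV)
  next
    assume s: "generic_symmetric x y"
    have "\<exists>i' j'. (i', j') \<in> {(i, j). i \<le> j} \<and> x i' j' = x i j \<and> {i', j'} = {i, j}" for i j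
    proof (cases "i \<le> j")
      case True
      then show ?thesis by (intro exI[of _ i] exI[of _ j]) simp
    next
      case False
      then show ?thesis
        using s by (intro exI[of _ j] exI[of _ i]) (auto simp: generic_symmetric_def)
    qed
    then show ?thesis
      using s unfolding generic_symmetric_def bij_betw_def by blast
  qed
  then obtain D where inj: "inj_on ?f (D <+> UNIV)"
    and D: "\<And>i j. \<exists>i' j'. (i', j') \<in> D \<and> x i' j' = x i j \<and> {i', j'} = {i, j}" by blast
  show "inj y"
  proof (rule injI)
    fix i j assume "y i = y j"
    then have "Inr i = (Inr j :: ('a \<times> 'a) + 'a)"
      by (intro inj_onD[OF inj]) auto
    then show "i = j" by simp
  qed
  have diag: "(k, k) \<in> D" for k using D[of k k] by auto
  show "x i i \<noteq> y j"
  proof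
    assume "x i i = y j"
    then have "Inl (i, i) = (Inr j :: ('a \<times> 'a) + 'a)"
      by (intro inj_onD[OF inj]) (auto simp: diag)
    then show False by simp
  qed
  show "x i j = x k k \<longleftrightarrow> i = k \<and> j = k"
  proof
    assume eq: "x i j = x k k"
    obtain i' j' where ij: "(i', j') \<in> D" "x i' j' = x i j" "{i', j'} = {i, j}" using D by blast
    have "Inl (i', j') = (Inl (k, k) :: ('a \<times> 'a) + 'a)"
      by (rule inj_onD[OF inj]) (use ij eq diag in auto)
    then show "i = k \<and> j = k" using ij(3) by auto
  qed simp
qed

theorem corollary6p2:
  fixes x :: "'n::{finite,linorder} \<Rightarrow> 'n \<Rightarrow> 'v" and y :: "'n \<Rightarrow> 'v"
    and X :: "('v, 'k::field) mpoly ^ ('n::{finite,linorder}) ^ ('n::{finite,linorder})" and Y g :: "('v, 'k) mpoly ^ ('n::{finite,linorder})"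
    and I :: "('v, 'k) mpoly set"
  assumes "generic x y \<or> generic_symmetric x y"
    and "X = (\<chi> i j. indet (x i j))"
    and "Y = (\<chi> j. indet (y j))"
    and "g = X *v Y"
    and "I = ideal_generated (range (\<lambda>i. g $ i))"
  shows "minimal_graded_free_resolution (koszul_complex (\<lambda>_. 2) (\<lambda>i. g $ i)) I \<and>
         (\<forall>i. betti_number I i = CARD('n) choose i)"
proof -
  note gen = generic_cases[OF assms(1)]
  define m where "m i = Poly_Mapping.single (x i i) 1 + Poly_Mapping.single (y i) (1::nat)" for i
  define c :: "'n \<Rightarrow> ('v, 'k) mpoly" where "c i = (\<Sum>j\<in>UNIV - {i}. indet (x i j) * indet (y j))" for i
  \<comment> \<open>The degree in the diagonal indeterminates.\<close>
  define wt where "wt b = (\<Sum>i\<in>UNIV. Poly_Mapping.lookup b (x i i))" for b :: "'v \<Rightarrow>\<^sub>0 nat"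
  have g: "g $ i = (\<Sum>j\<in>UNIV. indet (x i j) * indet (y j))" for i
    by (simp add: assms(2-4) matrix_vector_mult_def)
  have g_split: "g $ i = Poly_Mapping.single (m i) 1 + c i" for i
  proof -
    have "g $ i = indet (x i i) * indet (y i) + c i"
      unfolding g c_def by (rule sum.remove) simp_all
    then show ?thesis by (simp only: indet_mult_indet m_def)
  qed
  have wt_single: "wt (Poly_Mapping.single v k) = (if v \<in> range (\<lambda>i. x i i) then k else 0)" for v k
  proof (cases "v \<in> range (\<lambda>i. x i i)")
    case True
    then obtain j where v: "v = x j j" by blast
    have "wt (Poly_Mapping.single v k) = (\<Sum>i\<in>UNIV. if i = j then k else 0)"
      unfolding wt_def v by (rule sum.cong) (use gen(3) in \<open>auto simp: lookup_single when_def\<close>)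
    then show ?thesis using True by simp
  next
    case False
    then show ?thesis by (auto simp: wt_def lookup_single when_def)
  qed
  have wt_add: "wt (a + b) = wt a + wt b" for a b
    by (simp add: wt_def lookup_add sum.distrib)
  have y_wt: "y j \<notin> range (\<lambda>i. x i i)" for j
    using gen(2)[symmetric] by (simp add: image_iff)
  interpret coprime_leading_monomials m c wt
  proof
    show "Poly_Mapping.keys (m i) \<inter> Poly_Mapping.keys (m j) = {}" if "i \<noteq> j" for i j
    proof -
      have "Poly_Mapping.keys (m k) \<subseteq> {x k k, y k}" for k
        using keys_add[of "Poly_Mapping.single (x k k) 1" "Poly_Mapping.single (y k) (1::nat)"] by (auto simp: m_def)
      moreover have "{x i i, y i} \<inter> {x j j, y j} = {}"
        using that gen(2)[of i j] gen(2)[of j i] gen(3)[of i i j] injD[OF gen(1), of i j] by auto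
      ultimately show ?thesis by blast
    qed
    show "wt a < wt (m i)" if a: "a \<in> Poly_Mapping.keys (c i)" for a i
    proof -
      obtain j where j: "j \<noteq> i" "a \<in> Poly_Mapping.keys (indet (x i j) * indet (y j) :: ('v, 'k) mpoly)"
        using a keys_sum[of "\<lambda>j. indet (x i j) * indet (y j) :: ('v, 'k) mpoly" "UNIV - {i}"]
        unfolding c_def by blast
      then have "a = Poly_Mapping.single (x i j) 1 + Poly_Mapping.single (y j) 1"
        by (simp add: indet_mult_indet)
      moreover have "x i j \<notin> range (\<lambda>i. x i i)" using gen(3) j(1) by auto
      ultimately have "wt a = 0" by (simp add: wt_add wt_single y_wt)
      moreover have "wt (m i) = 1" by (simp add: m_def wt_add wt_single y_wt)
      ultimately show ?thesis by simp
    qed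
  qed (rule wt_add)
  have keys_g: "monomial_degree a = 2" if a: "a \<in> Poly_Mapping.keys (g $ i)" for a i
  proof -
    obtain j where "a \<in> Poly_Mapping.keys (indet (x i j) * indet (y j) :: ('v, 'k) mpoly)"
      using a[unfolded g] keys_sum[of "\<lambda>j. indet (x i j) * indet (y j) :: ('v, 'k) mpoly" UNIV]
      by blast
    then show ?thesis by (simp add: indet_mult_indet monomial_degree_add)
  qed
  have g_eq: "(\<lambda>i. g $ i) = (\<lambda>i. lead i + c i)" by (rule ext) (rule g_split)
  have res: "minimal_graded_free_resolution (koszul_complex (\<lambda>_. 2) (\<lambda>i. g $ i)) I"
    unfolding assms(5)
  proof (rule koszul_complex_minimal_resolution)
    show "homogeneous 2 (g $ i)" for i by (simp add: homogeneous_def keys_g)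
    show "g $ i \<in> irrelevant_ideal" for i
      using keys_g[of 0 i] by (auto simp: irrelevant_ideal_def in_keys_iff monomial_degree_def)
    show "\<exists>u\<in>free_module {S. card S = Suc (Suc p)}. koszul_diff (($) g) u = v"
      if "v \<in> free_module {S. card S = Suc p}" "koszul_diff (($) g) v = (\<lambda>_. 0)" for p v
      using that unfolding g_eq by (rule koszul_exact)
  qed
  moreover have "betti_number I i = CARD('n) choose i" for i
    using betti_number_eq[OF res, of i] n_subsets[of "UNIV :: 'n set" i] by (simp add: koszul_complex_def)
  ultimately show ?thesis by blast
qed

end
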